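(* For every integer $n\ge 6$, $ex^{c}_{\mathcal{OP}}(n,S_{2,2})=\left\lfloor\frac{3(n-1)}{2}\right\rfloor$.
   Context: All graphs are finite, simple and undirected. For integers $q\ge p\ge 1$, the double star $S_{p,q}$ is the graph obtained from an edge $xy$ by joining $x$ to $p$ new vertices and $y$ to $q$ further new vertices (so $S_{p,q}$ has $p+q+2$ vertices). A graph is $H$-free if it contains no subgraph isomorphic to $H$. A graph is outerplanar if it has a planar embedding with all vertices on the boundary of the outer face. $ex^{c}_{\mathcal{OP}}(n,H)$ denotes the maximum number of edges of a connected $H$-free outerplanar graph on $n$ vertices. *)

theory Defs
  imports "HOL-Analysis.Analysis"
begin

(* A graph is a pair of a vertex set and a set of edges, an edge being the set of its two
   endpoints. *)
type_synonym 'a graph = "'a set \<times> 'a set set"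

abbreviation verts :: "'a graph \<Rightarrow> 'a set" where
  "verts G \<equiv> fst G"

abbreviation edges :: "'a graph \<Rightarrow> 'a set set" where
  "edges G \<equiv> snd G"

definition simple_graph :: "'a graph \<Rightarrow> bool" where
  "simple_graph G \<longleftrightarrow> finite (verts G) \<and> (\<forall>e\<in>edges G. e \<subseteq> verts G \<and> card e = 2)"

definition connected_graph :: "'a graph \<Rightarrow> bool" where
  "connected_graph G \<longleftrightarrow> verts G \<noteq> {} \<and>
     (\<forall>u\<in>verts G. \<forall>v\<in>verts G. (u, v) \<in> {(a, b). {a, b} \<in> edges G}\<^sup>*)"

definition subgraph :: "'a graph \<Rightarrow> 'a graph \<Rightarrow> bool" where
  "subgraph H G \<longleftrightarrow> simple_graph H \<and> verts H \<subseteq> verts G \<and> edges H \<subseteq> edges G"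

definition graph_isomorphic :: "'a graph \<Rightarrow> 'b graph \<Rightarrow> bool" where
  "graph_isomorphic G H \<longleftrightarrow>
     (\<exists>f. bij_betw f (verts G) (verts H) \<and> edges H = (\<lambda>e. f ` e) ` edges G)"

definition H_free :: "'b graph \<Rightarrow> 'a graph \<Rightarrow> bool" where
  "H_free H G \<longleftrightarrow> \<not> (\<exists>G'. subgraph G' G \<and> graph_isomorphic G' H)"

(* The central edge is {0, 1}; the leaves at 0 are 2, ..., p + 1 and the leaves at 1 are
   p + 2, ..., p + q + 1. *)
definition double_star :: "nat \<Rightarrow> nat \<Rightarrow> nat graph" where
  "double_star p q =
     ({..<p + q + 2},
      {{0, 1}} \<union> (\<lambda>i. {0, i}) ` {2..<p + 2} \<union> (\<lambda>j. {1, j}) ` {p + 2..<p + q + 2})"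

(* A drawing in the plane without crossings: pos places the vertices and \<gamma> e is a simple arc
   representing the edge e. Its ends are the endpoints of e, it passes through no other vertex,
   and it meets other edges only in common endpoints. *)
definition planar_embedding ::
  "'a graph \<Rightarrow> ('a \<Rightarrow> complex) \<Rightarrow> ('a set \<Rightarrow> real \<Rightarrow> complex) \<Rightarrow> bool" where
  "planar_embedding G pos \<gamma> \<longleftrightarrow>
     inj_on pos (verts G) \<and>
     (\<forall>e\<in>edges G. arc (\<gamma> e) \<and> {pathstart (\<gamma> e), pathfinish (\<gamma> e)} = pos ` e \<and>
        path_image (\<gamma> e) \<inter> pos ` verts G = pos ` e) \<and>
     (\<forall>e\<in>edges G. \<forall>e'\<in>edges G. e \<noteq> e' \<longrightarrow>
        path_image (\<gamma> e) \<inter> path_image (\<gamma> e') = pos ` (e \<inter> e'))"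

definition drawing :: "'a graph \<Rightarrow> ('a \<Rightarrow> complex) \<Rightarrow> ('a set \<Rightarrow> real \<Rightarrow> complex) \<Rightarrow> complex set" where
  "drawing G pos \<gamma> = pos ` verts G \<union> (\<Union>e\<in>edges G. path_image (\<gamma> e))"

(* The faces are the components of the complement of the drawing. The drawing of a finite graph
   is compact, so exactly one face is unbounded, and this outer face is the outside of the
   drawing. *)
definition outerplanar :: "'a graph \<Rightarrow> bool" where
  "outerplanar G \<longleftrightarrow>
     (\<exists>pos \<gamma>. planar_embedding G pos \<gamma> \<and>
        pos ` verts G \<subseteq> frontier (outside (drawing G pos \<gamma>)))"

definition admissible_graphs :: "nat \<Rightarrow> 'b graph \<Rightarrow> nat graph set" where
  "admissible_graphs n H =
     {G. simple_graph G \<and> card (verts G) = n \<and> connected_graph G \<and> outerplanar G \<and> H_free H G}"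

(* Every finite graph has an isomorphic copy with vertices in nat, so letting G range over graphs
   on natural numbers loses nothing. *)
definition ex_c_OP :: "nat \<Rightarrow> 'b graph \<Rightarrow> nat" where
  "ex_c_OP n H = Max ((\<lambda>G. card (edges G)) ` admissible_graphs n H)"

(* Max is only meaningful for finite sets. *)
lemma finite_admissible_edge_counts:
  "finite ((\<lambda>G. card (edges G)) ` admissible_graphs n H)"
proof (rule finite_subset)
  have "card (edges G) \<le> 2 ^ n" if "G \<in> admissible_graphs n H" for G
  proof -
    have V: "finite (verts G)" "card (verts G) = n" and E: "edges G \<subseteq> Pow (verts G)"
      using that by (auto simp: admissible_graphs_def simple_graph_def)
    have "card (edges G) \<le> card (Pow (verts G))"
      using V E by (intro card_mono) auto
    then show ?thesis
      using V by (simp add: card_Pow)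
  qed
  then show "(\<lambda>G. card (edges G)) ` admissible_graphs n H \<subseteq> {..2 ^ n}"
    by auto
qed simp

end

theory Submission
  imports Defs
begin

text \<open>
  Besides \<open>S\<^sub>2\<^sub>,\<^sub>2\<close>-freeness, the counting argument uses only two consequences of outerplanarity:
  there is no \<open>K\<^sub>4\<close> and no theta graph, that is, no two vertices are joined by three internally
  disjoint paths that all have inner vertices. If two adjacent vertices have degree at least
  three, then \<open>S\<^sub>2\<^sub>,\<^sub>2\<close>-freeness leaves at most three further neighbours, so they lie in a triangle
  or in a diamond (\<open>K\<^sub>4\<close> minus an edge). Such a configuration can be deleted: either \<open>k\<close> vertices
  disappear together with at most \<open>3k/2\<close> edges, or a diamond with seven incident edges disappears
  and the graph falls apart. Leaves and adjacent vertices of degree two are deleted in the same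
  way. If no reduction applies, vertices of degree two alternate with vertices of larger degree,
  and a longest path starting at a vertex of large degree closes up to a theta graph. The bound
  \<open>2e \<le> 3(n - 1)\<close> fails for some graphs on four or five vertices; connectedness and \<open>n \<ge> 6\<close> enter
  only to show that every diamond is left by an edge and to control how it is left.

  For a theta graph drawn in the plane, Janiszewski's theorem shows that one of the three arcs
  runs inside the closed curve formed by the other two, while no vertex of an outerplanar drawing
  lies inside a cycle. The extremal graphs are the windmills: triangles sharing a vertex, plus a
  pendant edge if \<open>n\<close> is even.
\<close>

subsection \<open>Neighbourhoods and deletion of vertices\<close>

definition nbrs :: "'a set set \<Rightarrow> 'a \<Rightarrow> 'a set" where
  "nbrs E v = {u. {v, u} \<in> E}"

text \<open>Naming the six vertices replaces the isomorphism in
  \<open>H_free (double_star 2 2)\<close>; for simple graphs the two notions agree. The copy need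
  not be induced.\<close>

definition S22_free :: "'a set set \<Rightarrow> bool" where
  "S22_free E \<longleftrightarrow> (\<forall>x y a b c d. distinct [x, y, a, b, c, d] \<longrightarrow>
     \<not> {{x, y}, {x, a}, {x, b}, {y, c}, {y, d}} \<subseteq> E)"

definition K4_free :: "'a set set \<Rightarrow> bool" where
  "K4_free E \<longleftrightarrow> (\<forall>a b c d. distinct [a, b, c, d] \<longrightarrow>
     \<not> {{a, b}, {a, c}, {a, d}, {b, c}, {b, d}, {c, d}} \<subseteq> E)"

abbreviation walk :: "'a set set \<Rightarrow> 'a list \<Rightarrow> bool" where
  "walk E \<equiv> successively (\<lambda>u v. {u, v} \<in> E)"

text \<open>A forbidden configuration is a subdivision of K_{2,3}. Inner vertices are demanded on
  all three paths because a cycle with a chord does occur in outerplanar graphs.\<close>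

definition theta_free :: "'a set set \<Rightarrow> bool" where
  "theta_free E \<longleftrightarrow> (\<forall>p q l1 l2 l3. distinct (p # q # l1 @ l2 @ l3) \<and>
     l1 \<noteq> [] \<and> l2 \<noteq> [] \<and> l3 \<noteq> [] \<longrightarrow>
     \<not> (walk E (p # l1 @ [q]) \<and> walk E (p # l2 @ [q]) \<and> walk E (p # l3 @ [q])))"

text \<open>The order of the arguments matters: \<open>x\<close> and \<open>y\<close> span the edge
  common to both triangles, \<open>a\<close> and \<open>c\<close> are the tips. The tips may be
  adjacent, so a K_4 contains diamonds too.\<close>

definition diamond :: "'a set set \<Rightarrow> 'a \<Rightarrow> 'a \<Rightarrow> 'a \<Rightarrow> 'a \<Rightarrow> bool" where
  "diamond E x y a c \<longleftrightarrow> distinct [x, y, a, c] \<and> {{x, y}, {x, a}, {x, c}, {y, a}, {y, c}} \<subseteq> E"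

definition diamond_free :: "'a set set \<Rightarrow> bool" where
  "diamond_free E \<longleftrightarrow> (\<forall>x y a c. \<not> diamond E x y a c)"

lemma S22_free_mono: "S22_free E \<Longrightarrow> E' \<subseteq> E \<Longrightarrow> S22_free E'"
  unfolding S22_free_def by (meson order_trans)

lemma theta_free_mono: "theta_free E \<Longrightarrow> E' \<subseteq> E \<Longrightarrow> theta_free E'"
  unfolding theta_free_def
  by (metis (no_types, lifting) subsetD successively_mono)

lemma diamond_mono: "diamond E' x y a c \<Longrightarrow> E' \<subseteq> E \<Longrightarrow> diamond E x y a c"
  unfolding diamond_def by (meson order_trans)

lemma diamond_free_mono: "diamond_free E \<Longrightarrow> E' \<subseteq> E \<Longrightarrow> diamond_free E'"
  unfolding diamond_free_def using diamond_mono by metis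

lemma K4_free_mono: "K4_free E \<Longrightarrow> E' \<subseteq> E \<Longrightarrow> K4_free E'"
  unfolding K4_free_def by (meson order_trans)

lemma S22_freeD:
  assumes "S22_free E" "distinct [x, y, a, b, c, d]"
    "{x, y} \<in> E" "{x, a} \<in> E" "{x, b} \<in> E" "{y, c} \<in> E" "{y, d} \<in> E"
  shows False
  using assms unfolding S22_free_def by blast

lemma nbrs_iff: "u \<in> nbrs E v \<longleftrightarrow> {v, u} \<in> E"
  by (simp add: nbrs_def)

lemma nbrs_sym: "u \<in> nbrs E v \<longleftrightarrow> v \<in> nbrs E u"
  by (simp add: nbrs_def insert_commute)

lemma singleton_not_edge: "simple_graph (V, E) \<Longrightarrow> {v} \<notin> E"
  by (auto simp: simple_graph_def)

lemma not_nbrs_self: "simple_graph (V, E) \<Longrightarrow> v \<notin> nbrs E v"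
  by (simp add: nbrs_def singleton_not_edge)

lemma nbrs_verts:
  assumes "simple_graph (V, E)" "u \<in> nbrs E v"
  shows "u \<in> V" "v \<in> V" "u \<noteq> v"
  using assms not_nbrs_self by (auto simp: simple_graph_def nbrs_def)

lemma finite_nbrs: "simple_graph (V, E) \<Longrightarrow> finite (nbrs E v)"
  by (rule finite_subset[of _ V]) (auto intro: nbrs_verts(1) simp: simple_graph_def)

lemma finite_edges: "simple_graph (V, E) \<Longrightarrow> finite E"
  by (rule finite_subset[of _ "Pow V"]) (auto simp: simple_graph_def)

lemma edge_cases:
  assumes "simple_graph (V, E)" "e \<in> E" "u \<in> e"
  obtains w where "e = {u, w}" "w \<in> nbrs E u"
proof -
  obtain p q where "e = {p, q}"
    using assms by (metis card_2_iff simple_graph_def snd_conv)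
  then show thesis
    using assms that by (auto simp: nbrs_def insert_commute)
qed

lemma simple_graph_restrict:
  "simple_graph (V, E) \<Longrightarrow> simple_graph (V - U, {e \<in> E. e \<inter> U = {}})"
  by (auto simp: simple_graph_def)

text \<open>\<open>F\<close> covers all edges that meet \<open>U\<close>. Being a list, it bounds
  their number by its length even if entries coincide or are not edges, so no distinctness has to be
  checked in applications.\<close>

lemma card_edges_remove:
  assumes G: "simple_graph (V, E)"
    and F: "\<And>u w. u \<in> U \<Longrightarrow> w \<in> nbrs E u \<Longrightarrow> {u, w} \<in> set F"
  shows "card E \<le> card {e \<in> E. e \<inter> U = {}} + length F"
proof -
  have "E \<subseteq> {e \<in> E. e \<inter> U = {}} \<union> set F"
  proof
    fix e assume e: "e \<in> E"
    show "e \<in> {e \<in> E. e \<inter> U = {}} \<union> set F"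
    proof (cases "e \<inter> U = {}")
      case False
      then obtain u where u: "u \<in> e" "u \<in> U" by auto
      then obtain w where "e = {u, w}" "w \<in> nbrs E u"
        using edge_cases[OF G e] by blast
      then show ?thesis using F u by blast
    qed (use e in simp)
  qed
  then have "card E \<le> card ({e \<in> E. e \<inter> U = {}} \<union> set F)"
    by (intro card_mono) (auto simp: finite_edges[OF G])
  also have "\<dots> \<le> card {e \<in> E. e \<inter> U = {}} + card (set F)"
    by (rule card_Un_le)
  finally show ?thesis
    using card_length[of F] by linarith
qed

text \<open>The form common to most reductions: a deletion costing at most 3/2 edges per vertex
  preserves the bound. Writing \<open>+ 3\<close> on the left avoids subtraction on natural
  numbers.\<close>

lemma edge_bound_remove:
  assumes G: "simple_graph (V, E)"
    and U: "U \<subseteq> V" "2 * length F \<le> 3 * card U"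
    and F: "\<And>u w. u \<in> U \<Longrightarrow> w \<in> nbrs E u \<Longrightarrow> {u, w} \<in> set F"
    and IH: "2 * card {e \<in> E. e \<inter> U = {}} + 3 \<le> 3 * card (V - U)"
  shows "2 * card E + 3 \<le> 3 * card V"
proof -
  have "finite V" using G by (simp add: simple_graph_def)
  then have "card (V - U) + card U = card V"
    using U(1) card_Diff_subset[of U V] card_mono[of V U] finite_subset[of U V] by simp
  moreover have "card E \<le> card {e \<in> E. e \<inter> U = {}} + length F"
    using card_edges_remove[OF G F] .
  ultimately show ?thesis
    using U(2) IH by linarith
qed

section \<open>Consequences of forbidding S_{2,2}\<close>

text \<open>If \<open>A \<union> B\<close> had four elements, then disjoint pairs could be chosen
  from \<open>A\<close> and \<open>B\<close>, as each has at least two elements. The pairs would be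
  the leaves of a double star with central edge \<open>{x, y}\<close>.\<close>

lemma S22_free_nbrs_Un:
  assumes G: "simple_graph (V, E)" and S: "S22_free E" and xy: "y \<in> nbrs E x"
    and A: "A = nbrs E x - {y}" "2 \<le> card A" and B: "B = nbrs E y - {x}" "2 \<le> card B"
  shows "card (A \<union> B) \<le> 3"
proof (rule ccontr)
  assume "\<not> card (A \<union> B) \<le> 3"
  then have 4: "4 \<le> card (A \<union> B)" by simp
  have fin: "finite A" "finite B"
    using A B finite_nbrs[OF G] by auto
  have split: "card (A \<union> B) = card A + card (B - A)"
    using fin by (metis Un_Diff_cancel card_Un_disjoint Diff_disjoint finite_Diff)
  \<comment> \<open>The pair in \<open>B\<close> is taken outside \<open>A\<close> as far as
    possible, so that two elements of \<open>A\<close> remain. If it contains all of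
    \<open>B - A\<close>, then it and \<open>A - B'\<close> partition
    \<open>A \<union> B\<close>.\<close>
  obtain B' where B': "B' \<subseteq> B" "card B' = 2" "2 \<le> card (A - B')"
  proof (cases "2 \<le> card (B - A)")
    case True
    then obtain B' where "B' \<subseteq> B - A" "card B' = 2"
      by (meson obtain_subset_with_card_n)
    moreover from this have "A - B' = A" by auto
    ultimately show thesis using that[of B'] A(2) by auto
  next
    case False
    then have "card (B - A) \<le> 1" by simp
    obtain B' where "B - A \<subseteq> B'" "B' \<subseteq> B" "card B' = 2"
      using exists_subset_between[of "B - A" 2 B] False B(2) fin by auto
    moreover have "card (A - B') + card B' = card (A \<union> B)"
    proof -
      have "A \<union> B = (A - B') \<union> B'" using calculation by auto
      then show ?thesis
        using fin calculation by (metis Diff_disjoint Int_commute card_Un_disjoint finite_Diff finite_subset)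
    qed
    ultimately show thesis using that 4 by auto
  qed
  obtain A' where A': "A' \<subseteq> A - B'" "card A' = 2"
    using B'(3) by (meson obtain_subset_with_card_n)
  obtain a b where ab: "A' = {a, b}" "a \<noteq> b" using A' by (auto simp: card_2_iff)
  obtain c d where cd: "B' = {c, d}" "c \<noteq> d" using B' by (auto simp: card_2_iff)
  have *: "a \<in> A" "b \<in> A" "c \<in> B" "d \<in> B" "a \<noteq> c" "a \<noteq> d" "b \<noteq> c" "b \<noteq> d"
    using ab cd A' B' by auto
  show False
  proof (rule S22_freeD[OF S])
    show "distinct [x, y, a, b, c, d]"
      using * ab(2) cd(2) xy not_nbrs_self[OF G, of x] not_nbrs_self[OF G, of y]
      unfolding A(1) B(1) by auto
    show "{x, y} \<in> E" "{x, a} \<in> E" "{x, b} \<in> E" "{y, c} \<in> E" "{y, d} \<in> E"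
      using * xy unfolding A(1) B(1) by (simp_all add: nbrs_iff)
  qed
qed

text \<open>Without a diamond, \<open>A\<close> and \<open>B\<close> share at most one vertex. Each
  has at least two vertices and their union at most three, so counting leaves two pairs with exactly
  one common vertex, the third corner \<open>c\<close> of a triangle.\<close>

lemma big_edge_triangle:
  assumes G: "simple_graph (V, E)" and S: "S22_free E" and D: "diamond_free E"
    and xy: "y \<in> nbrs E x" and x: "3 \<le> card (nbrs E x)" and y: "3 \<le> card (nbrs E y)"
  obtains a b c where "nbrs E x = {y, a, c}" "nbrs E y = {x, b, c}" "distinct [x, y, a, b, c]"
proof -
  define A where "A = nbrs E x - {y}"
  define B where "B = nbrs E y - {x}"
  have fin: "finite A" "finite B"
    using finite_nbrs[OF G] by (auto simp: A_def B_def)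
  have yx: "x \<in> nbrs E y" using xy nbrs_sym by metis
  have c: "2 \<le> card A" "2 \<le> card B"
    using x y xy yx finite_nbrs[OF G] by (auto simp: A_def B_def)
  have un: "card (A \<union> B) \<le> 3"
    using S22_free_nbrs_Un[OF G S xy A_def c(1) B_def c(2)] .
  have int: "card (A \<inter> B) \<le> 1"
  proof (rule ccontr)
    assume "\<not> card (A \<inter> B) \<le> 1"
    then obtain a c where "a \<in> A \<inter> B" "c \<in> A \<inter> B" "a \<noteq> c"
      by (metis card_le_Suc0_iff_eq fin(1) finite_Int One_nat_def)
    then have "diamond E x y a c"
      using xy nbrs_verts[OF G] singleton_not_edge[OF G] by (auto simp: diamond_def A_def B_def nbrs_iff)
    then show False using D by (auto simp: diamond_free_def)
  qed
  have "card A + card B = card (A \<union> B) + card (A \<inter> B)"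
    using fin by (rule card_Un_Int)
  then have cc: "card A = 2" "card B = 2" "card (A \<inter> B) = 1"
    using un int c by auto
  then obtain c where c: "A \<inter> B = {c}" by (auto simp: card_1_singleton_iff)
  then obtain a where a: "A = {a, c}" "a \<noteq> c"
    using cc(1) by (metis Int_iff card_2_iff insert_commute insert_iff singleton_iff)
  obtain b where b: "B = {b, c}" "b \<noteq> c"
    using cc(2) c by (metis Int_iff card_2_iff insert_commute insert_iff singleton_iff)
  have "a \<noteq> b" using a b c by auto
  show thesis
  proof (rule that)
    show "nbrs E x = {y, a, c}" "nbrs E y = {x, b, c}"
      using a b xy yx by (auto simp: A_def B_def)
    have "a \<in> A" "c \<in> A" "b \<in> B" "c \<in> B"
      using a b by auto
    then show "distinct [x, y, a, b, c]"
      using \<open>a \<noteq> b\<close> a(2) b(2) xy not_nbrs_self[OF G, of x] not_nbrs_self[OF G, of y]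
      by (auto simp: A_def B_def)
  qed
qed

text \<open>Two neighbours of \<open>a\<close> other than \<open>x\<close>, together with
  \<open>u\<close> and \<open>v\<close>, would be the leaves of a double star with central edge
  \<open>{x, a}\<close>. The hypotheses on \<open>u\<close> and \<open>v\<close> keep the leaves
  distinct.\<close>

lemma S22_free_pendant:
  assumes G: "simple_graph (V, E)" and S: "S22_free E"
    and a: "x \<in> nbrs E a" "u \<in> nbrs E x" "v \<in> nbrs E x" "u \<noteq> v" "u \<notin> nbrs E a" "v \<notin> nbrs E a"
    "u \<noteq> a" "v \<noteq> a"
  shows "\<exists>w. nbrs E a \<subseteq> {x, w}"
proof -
  have "s = t" if "s \<in> nbrs E a - {x}" "t \<in> nbrs E a - {x}" for s t
  proof (rule ccontr)
    assume "s \<noteq> t"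
    show False
    proof (rule S22_freeD[OF S])
      show "distinct [x, a, u, v, s, t]"
        using that a not_nbrs_self[OF G, of a] not_nbrs_self[OF G, of x] \<open>s \<noteq> t\<close> by auto
      show "{x, a} \<in> E" "{x, u} \<in> E" "{x, v} \<in> E" "{a, s} \<in> E" "{a, t} \<in> E"
        using that a by (simp_all add: nbrs_iff insert_commute)
    qed
  qed
  then show ?thesis by blast
qed

subsection \<open>Diamond-free graphs\<close>

text \<open>The edge lies in a triangle \<open>x\<close>, \<open>y\<close>, \<open>c\<close>. If
  \<open>c\<close> has degree two, the triangle and \<open>a\<close> are deleted; otherwise the
  triangle and the outer neighbour of each corner. The outer neighbours have degree at most two by
  \<open>S22_free_pendant\<close>.\<close>

lemma big_edge_bound:
  assumes G: "simple_graph (V, E)" and S: "S22_free E" and D: "diamond_free E"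
    and deg: "\<And>v. v \<in> V \<Longrightarrow> 2 \<le> card (nbrs E v)"
    and xy: "y \<in> nbrs E x" and x: "3 \<le> card (nbrs E x)" and y: "3 \<le> card (nbrs E y)"
    and IH: "\<And>U. U \<subseteq> V \<Longrightarrow> U \<noteq> {} \<Longrightarrow> U \<noteq> V \<Longrightarrow>
      2 * card {e \<in> E. e \<inter> U = {}} + 3 \<le> 3 * card (V - U)"
  shows "2 * card E + 3 \<le> 3 * card V"
proof -
  obtain a b c where nx: "nbrs E x = {y, a, c}" and ny: "nbrs E y = {x, b, c}"
    and dist: "distinct [x, y, a, b, c]"
    using big_edge_triangle[OF G S D xy x y] .
  have inV: "x \<in> V" "y \<in> V" "a \<in> V" "b \<in> V" "c \<in> V"
    using nbrs_verts[OF G, of _ x] nbrs_verts[OF G, of _ y] nx ny by auto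
  have sym: "u \<in> nbrs E v \<Longrightarrow> v \<in> nbrs E u" for u v
    using nbrs_sym by metis
  have no_diamond: "\<not> diamond E p q r s" for p q r s
    using D by (simp add: diamond_free_def)
  have e: "{x, y} \<in> E" "{x, a} \<in> E" "{x, c} \<in> E" "{y, b} \<in> E" "{y, c} \<in> E"
    by (simp_all add: nbrs_iff[symmetric] nx ny)
  have ac: "a \<notin> nbrs E c" "c \<notin> nbrs E a"
    using no_diamond[of x c y a] e dist by (auto simp: diamond_def nbrs_iff insert_commute)
  have bc: "b \<notin> nbrs E c" "c \<notin> nbrs E b"
    using no_diamond[of y c x b] e dist by (auto simp: diamond_def nbrs_iff insert_commute)
  have ay: "y \<notin> nbrs E a" "x \<notin> nbrs E b" "x \<in> nbrs E a" "y \<in> nbrs E b" "x \<in> nbrs E c" "y \<in> nbrs E c"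
    using nbrs_sym[of y E a] nbrs_sym[of x E b] nbrs_sym[of x E a] nbrs_sym[of y E b]
      nbrs_sym[of x E c] nbrs_sym[of y E c] nx ny dist by auto
  obtain a' where a': "nbrs E a \<subseteq> {x, a'}"
    using S22_free_pendant[OF G S, of x a y c] nx dist ac ay by auto
  obtain b' where b': "nbrs E b \<subseteq> {y, b'}"
    using S22_free_pendant[OF G S, of y b x c] ny dist bc ay by auto
  show ?thesis
  proof (cases "3 \<le> card (nbrs E c)")
    case False
    then have nc: "nbrs E c = {x, y}"
      using ay finite_nbrs[OF G, of c] dist
      by (intro card_subset_eq[symmetric] card_seteq[symmetric]) auto
    \<comment> \<open>Six edges for four vertices. The vertex \<open>b\<close> stays, so the rest is
      nonempty.\<close>
    show ?thesis
    proof (rule edge_bound_remove[OF G, of "{x, y, c, a}" "[{x,y},{x,a},{x,c},{y,b},{y,c},{a,a'}]"])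
      show "2 * card {e \<in> E. e \<inter> {x, y, c, a} = {}} + 3 \<le> 3 * card (V - {x, y, c, a})"
        using inV dist by (intro IH) auto
    next
      fix u w assume "u \<in> {x, y, c, a}" and w: "w \<in> nbrs E u"
      then consider "u = x" | "u = y" | "u = c" | "u = a" by blast
      then show "{u, w} \<in> set [{x,y},{x,a},{x,c},{y,b},{y,c},{a,a'}]"
      proof cases
        case 1
        then have "w = y \<or> w = a \<or> w = c"
          using w nx by simp
        then have "{u, w} = {x,y} \<or> {u, w} = {x,a} \<or> {u, w} = {x,c}" using 1 by blast
        then show ?thesis by (elim disjE) (simp_all only: list.set insert_iff simp_thms)
      next
        case 2
        then have "w = x \<or> w = b \<or> w = c"
          using w ny by simp
        then have "{u, w} = {x,y} \<or> {u, w} = {y,b} \<or> {u, w} = {y,c}" using 2 by blast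
        then show ?thesis by (elim disjE) (simp_all only: list.set insert_iff simp_thms)
      next
        case 3
        then have "w = x \<or> w = y"
          using w nc by simp
        then have "{u, w} = {x,c} \<or> {u, w} = {y,c}" using 3 by blast
        then show ?thesis by (elim disjE) (simp_all only: list.set insert_iff simp_thms)
      next
        case 4
        then have "w = x \<or> w = a'" using w a' by blast
        then have "{u, w} = {x,a} \<or> {u, w} = {a, a'}" using 4 by blast
        then show ?thesis by (elim disjE) (simp_all only: list.set insert_iff simp_thms)
      qed
    qed (use inV dist in auto)
  next
    case True
    have "c \<in> nbrs E x" using nx by simp
    then obtain a2 b2 c2 where nx2: "nbrs E x = {c, a2, c2}" and nc: "nbrs E c = {x, b2, c2}"
      and dist2: "distinct [x, c, a2, b2, c2]"
      using big_edge_triangle[OF G S D \<open>c \<in> nbrs E x\<close> x True] by metis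
    \<comment> \<open>The triangle on the edge \<open>{x, c}\<close> is the same one: its third
      corner is a neighbour \<open>y\<close> or \<open>a\<close> of \<open>x\<close>, and
      \<open>a\<close> is not adjacent to \<open>c\<close>. So \<open>c\<close> has a single further
      neighbour \<open>w\<close>.\<close>
    obtain w where nc: "nbrs E c = {x, y, w}" "w \<notin> {x, y, c, a, b}"
    proof -
      have "c2 = y \<or> c2 = a" using nx nx2 dist2 by auto
      moreover have "c2 \<noteq> a" using ac nc by auto
      ultimately have "c2 = y" by simp
      then have "a2 = a" using nx nx2 dist2 dist by auto
      have "b2 \<noteq> b" "b2 \<noteq> a" using bc ac nc by auto
      then show thesis using that[of b2] nc \<open>c2 = y\<close> dist2 by auto
    qed
    have wV: "w \<in> V" using nbrs_verts[OF G, of w c] nc by simp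
    have w: "c \<in> nbrs E w" "x \<notin> nbrs E w" "y \<notin> nbrs E w"
      using nbrs_sym[of c E w] nbrs_sym[of x E w] nbrs_sym[of y E w] nc nx ny by auto
    obtain w' where w': "nbrs E w \<subseteq> {c, w'}"
      using S22_free_pendant[OF G S, of c w x y] nc dist w by auto
    let ?U = "{x, y, c, a, b, w}"
    \<comment> \<open>Nine edges for six vertices: the three sides, one edge from each corner to its
      outer neighbour, and at most one further edge at each of \<open>a\<close>, \<open>b\<close>
      and \<open>w\<close>.\<close>
    show ?thesis
    proof (rule edge_bound_remove[OF G, of ?U
          "[{x,y},{x,c},{y,c},{x,a},{y,b},{c,w},{a,a'},{b,b'},{w,w'}]"])
      show "2 * card {e \<in> E. e \<inter> ?U = {}} + 3 \<le> 3 * card (V - ?U)"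
      proof (rule IH)
        have other: "\<exists>z. z \<in> nbrs E v \<and> z \<noteq> u" if "v \<in> V" for u v
        proof (rule ccontr)
          assume "\<not> ?thesis"
          then have "nbrs E v \<subseteq> {u}" by blast
          then have "card (nbrs E v) \<le> card {u}" by (intro card_mono) auto
          then show False using deg[OF that] by simp
        qed
        have na: "nbrs E a = {x, a'}" "a' \<noteq> x" using other[of a x] inV a' ay by auto
        have nb: "nbrs E b = {y, b'}" "b' \<noteq> y" using other[of b y] inV b' ay by auto
        have nw: "nbrs E w = {c, w'}" "w' \<noteq> c" using other[of w c] wV w' w by auto
        \<comment> \<open>Otherwise the remaining edges would be a perfect matching of the three vertices a, b, w.\<close>
        show "?U \<noteq> V"
        proof
          assume U: "?U = V"
          have s: "a' \<in> ?U" "b' \<in> ?U" "w' \<in> ?U"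
            using nbrs_verts(1)[OF G, of a' a] nbrs_verts(1)[OF G, of b' b]
              nbrs_verts(1)[OF G, of w' w] na nb nw U by auto
          have "a' = b \<or> a' = w"
            using s(1) na ay ac not_nbrs_self[OF G, of a] by auto
          moreover have "b' = a \<or> b' = w"
            using s(2) nb ay bc not_nbrs_self[OF G, of b] by auto
          moreover have "w' = a \<or> w' = b"
            using s(3) nw w not_nbrs_self[OF G, of w] by auto
          moreover have "a \<in> nbrs E a'" "b \<in> nbrs E b'" "w \<in> nbrs E w'"
            using sym[of a' a] sym[of b' b] sym[of w' w] na nb nw by auto
          ultimately show False
            using na(1) nb(1) nw(1) ay ac(1) bc(1) nc dist by (metis insert_iff singleton_iff distinct_length_2_or_more)
        qed
      qed (use inV wV in auto)
      show "2 * length [{x,y},{x,c},{y,c},{x,a},{y,b},{c,w},{a,a'},{b,b'},{w,w'}] \<le> 3 * card ?U"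
        using dist nc by (auto simp: card_insert_if)
    next
      fix u v assume "u \<in> ?U" and v: "v \<in> nbrs E u"
      then consider "u = x" | "u = y" | "u = c" | "u = a" | "u = b" | "u = w" by blast
      then show "{u, v} \<in> set [{x,y},{x,c},{y,c},{x,a},{y,b},{c,w},{a,a'},{b,b'},{w,w'}]"
      proof cases
        case 1
        then have "v = y \<or> v = a \<or> v = c"
          using v nx by simp
        then have "{u, v} = {x,y} \<or> {u, v} = {x,a} \<or> {u, v} = {x,c}" using 1 by blast
        then show ?thesis by (elim disjE) (simp_all only: list.set insert_iff simp_thms)
      next
        case 2
        then have "v = x \<or> v = b \<or> v = c"
          using v ny by simp
        then have "{u, v} = {x,y} \<or> {u, v} = {y,b} \<or> {u, v} = {y,c}" using 2 by blast
        then show ?thesis by (elim disjE) (simp_all only: list.set insert_iff simp_thms)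
      next
        case 3
        then have "v = x \<or> v = y \<or> v = w"
          using v nc by simp
        then have "{u, v} = {x,c} \<or> {u, v} = {y,c} \<or> {u, v} = {c,w}" using 3 by blast
        then show ?thesis by (elim disjE) (simp_all only: list.set insert_iff simp_thms)
      next
        case 4
        then have "v = x \<or> v = a'" using v a' by blast
        then have "{u, v} = {x,a} \<or> {u, v} = {a, a'}" using 4 by blast
        then show ?thesis by (elim disjE) (simp_all only: list.set insert_iff simp_thms)
      next
        case 5
        then have "v = y \<or> v = b'" using v b' by blast
        then have "{u, v} = {y,b} \<or> {u, v} = {b, b'}" using 5 by blast
        then show ?thesis by (elim disjE) (simp_all only: list.set insert_iff simp_thms)
      next
        case 6
        then have "v = c \<or> v = w'" using v w' by blast
        then have "{u, v} = {c,w} \<or> {u, v} = {w, w'}" using 6 by blast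
        then show ?thesis by (elim disjE) (simp_all only: list.set insert_iff simp_thms)
      qed
    qed (use inV wV in auto)
  qed
qed

text \<open>Let \<open>p # s1 # P'\<close> be a longest path from a vertex of degree at least three.
  Two further neighbours \<open>s2\<close>, \<open>s3\<close> of \<open>p\<close> have degree two,
  and by maximality their other neighbours \<open>q2\<close>, \<open>q3\<close> lie on
  \<open>P'\<close>. The path and these two ears contain a theta graph.\<close>

lemma theta_of_alternating_degrees:
  assumes G: "simple_graph (V, E)" and V: "V \<noteq> {}"
    and deg: "\<And>v. v \<in> V \<Longrightarrow> 2 \<le> card (nbrs E v)"
    and small: "\<And>u v. v \<in> nbrs E u \<Longrightarrow> card (nbrs E u) = 2 \<Longrightarrow> 3 \<le> card (nbrs E v)"
    and big: "\<And>u v. v \<in> nbrs E u \<Longrightarrow> 3 \<le> card (nbrs E u) \<Longrightarrow> card (nbrs E v) = 2"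
  shows "\<not> theta_free E"
proof
  assume T: "theta_free E"
  have sym: "u \<in> nbrs E v \<Longrightarrow> v \<in> nbrs E u" for u v
    using nbrs_sym by metis
  define ok where "ok P \<longleftrightarrow> distinct P \<and> walk E P \<and> P \<noteq> [] \<and> 3 \<le> card (nbrs E (hd P)) \<and> set P \<subseteq> V" for P
  have finV: "finite V" using G by (simp add: simple_graph_def)
  have "\<exists>p0 \<in> V. 3 \<le> card (nbrs E p0)"
  proof -
    obtain v where v: "v \<in> V" using V by blast
    then obtain u where "u \<in> nbrs E v" using deg[OF v] by fastforce
    then show ?thesis
      using small[of u v] deg[OF v] v nbrs_verts(1)[OF G, of u v]
      by (cases "card (nbrs E v) = 2") force+
  qed
  then obtain p0 where "ok [p0]" by (auto simp: ok_def)
  moreover have "length P \<le> card V" if "ok P" for P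
    using that card_mono[OF finV, of "set P"] by (simp add: ok_def distinct_card)
  ultimately obtain P where P: "ok P" and max: "\<And>Q. ok Q \<Longrightarrow> length Q \<le> length P"
    using ex_has_greatest_nat[of ok "[p0]" length "Suc (card V)"] by (metis le_imp_less_Suc)
  define p where "p = hd P"
  have p3: "3 \<le> card (nbrs E p)" using P by (simp add: ok_def p_def)
  have step: "\<exists>q. nbrs E s = {p, q} \<and> q \<noteq> p \<and> 3 \<le> card (nbrs E q)" if s: "s \<in> nbrs E p" for s
  proof -
    have "card (nbrs E s) = 2" "p \<in> nbrs E s" using big[OF s p3] s sym by auto
    then obtain q where "nbrs E s = {p, q}" "q \<noteq> p"
      by (auto simp: card_2_iff doubleton_eq_iff)
    moreover from this have "q \<in> nbrs E s" by simp
    ultimately show ?thesis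
      using small[of q s] \<open>card (nbrs E s) = 2\<close> by blast
  qed
  have neq: "s \<noteq> q" if "s \<in> nbrs E p" "3 \<le> card (nbrs E q)" for s q
    using big[OF that(1) p3] that by auto
  obtain s where s: "s \<in> nbrs E p" using p3 by fastforce
  obtain q where q: "nbrs E s = {p, q}" "q \<noteq> p" "3 \<le> card (nbrs E q)" using step[OF s] by auto
  have "ok [q, s, p]"
    using s q neq[OF s q(3)] neq[OF s p3] nbrs_verts[OF G, of s p] nbrs_verts[OF G, of q s]
    by (auto simp: ok_def nbrs_def insert_commute)
  then have "3 \<le> length P" using max by fastforce
  then obtain s1 q1 R where PR: "P = p # s1 # q1 # R"
    unfolding p_def by (cases P; cases "tl P"; cases "tl (tl P)") auto
  define P' where "P' = q1 # R"
  have P': "P = p # s1 # P'" by (simp add: PR P'_def)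
  have dP: "distinct (p # s1 # P')" and wP: "walk E (p # s1 # P')" and sP: "set P \<subseteq> V"
    using P by (auto simp: ok_def P')
  have s1: "s1 \<in> nbrs E p" "q1 \<in> nbrs E s1"
    using wP by (auto simp: P'_def nbrs_iff)
  have q1: "3 \<le> card (nbrs E q1)" using small[OF s1(2)] big[OF s1(1) p3] by simp
  \<comment> \<open>If \<open>s\<close> is off \<open>P'\<close>, then \<open>q\<close> is on it,
    since otherwise \<open>q # s # P\<close> would be longer. If \<open>s\<close> is on
    \<open>P'\<close>, its predecessor there is \<open>q\<close>, because \<open>p\<close> is used
    already, and no neighbour is left for a successor, so \<open>s\<close> comes last.\<close>
  have ear: "q \<in> set P' \<and> (s \<in> set P' \<longrightarrow> s = last P')"
    if s: "s \<in> nbrs E p" "s \<noteq> s1" and q: "nbrs E s = {p, q}" "q \<noteq> p" "3 \<le> card (nbrs E q)" for s q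
  proof (cases "s \<in> set P'")
    case False
    have "q \<in> set P"
    proof (rule ccontr)
      assume "q \<notin> set P"
      then have "ok (q # s # P)"
        using P s q False neq[OF s(1) q(3)] neq[OF s(1) p3] nbrs_verts[OF G, of s p] nbrs_verts[OF G, of q s]
        by (auto simp: ok_def P' nbrs_def insert_commute)
      then show False using max by fastforce
    qed
    then show ?thesis using False q neq[OF s1(1) q(3)] by (auto simp: P')
  next
    case True
    then obtain A B where AB: "P' = A @ s # B" by (auto dest: split_list)
    have "A \<noteq> []" using neq[OF s(1) q1] AB by (auto simp: P'_def)
    then have "{last A, s} \<in> E"
      using wP AB by (auto simp: successively_append_iff successively_Cons)
    then have "last A \<in> {p, q}" unfolding q(1)[symmetric] by (simp add: nbrs_iff insert_commute)
    then have lA: "last A = q" using dP AB \<open>A \<noteq> []\<close> by auto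
    have "B = []"
    proof (rule ccontr)
      assume "B \<noteq> []"
      then have "{s, hd B} \<in> E"
        using wP AB by (auto simp: successively_append_iff successively_Cons)
      then have "hd B \<in> {p, q}" unfolding q(1)[symmetric] by (simp add: nbrs_iff)
      moreover have "hd B \<in> set B" "last A \<in> set A" using \<open>A \<noteq> []\<close> \<open>B \<noteq> []\<close> by auto
      ultimately show False using lA dP AB by auto
    qed
    then show ?thesis using lA AB \<open>A \<noteq> []\<close> by auto
  qed
  \<comment> \<open>Here \<open>q2\<close> comes no later than \<open>q3\<close> on
    \<open>P'\<close>. The three paths from \<open>p\<close> to \<open>q2\<close> run along
    \<open>P\<close>, through \<open>s2\<close>, and through \<open>s3\<close> and \<open>q3\<close>
    and then backwards along \<open>P\<close>.\<close>
  have key: False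
    if P'_eq: "P' = A @ q2 # C" and C: "q3 \<in> set (q2 # C)"
      and s2: "s2 \<in> nbrs E p" "s2 \<noteq> s1" "nbrs E s2 = {p, q2}" "q2 \<noteq> p" "3 \<le> card (nbrs E q2)"
      and s3: "s3 \<in> nbrs E p" "s3 \<noteq> s1" "nbrs E s3 = {p, q3}" "q3 \<noteq> p" "3 \<le> card (nbrs E q3)"
      and ne: "s2 \<noteq> s3" for A C q2 q3 s2 s3
  proof -
    have e: "{p, s2} \<in> E" "{s2, q2} \<in> E" "{p, s3} \<in> E" "{s3, q3} \<in> E"
      using s2 s3 by (auto simp: nbrs_def)
    have l: "s2 \<in> set P' \<longrightarrow> s2 = last P'" "s3 \<in> set P' \<longrightarrow> s3 = last P'"
      using ear s2 s3 by blast+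
    have n: "s2 \<noteq> q2" "s2 \<noteq> q3" "s3 \<noteq> q2" "s3 \<noteq> q3" "s2 \<noteq> p" "s3 \<noteq> p"
      using neq s2 s3 p3 by blast+
    have w1: "walk E (p # (s1 # A) @ [q2])"
      using wP by (auto simp: P'_eq successively_append_iff successively_Cons hd_append)
    have w2: "walk E (p # [s2] @ [q2])" using e by simp
    obtain C1 C2 where C12: "q2 # C = C1 @ q3 # C2"
      using C by (meson split_list)
    \<comment> \<open>An ear vertex on \<open>P'\<close> is its last vertex, which lies beyond
      \<open>A\<close> and \<open>C1\<close>, since these end before \<open>q3\<close>.\<close>
    have notin: "s \<notin> set (A @ C1)" if "s \<in> set P' \<longrightarrow> s = last P'" "s \<noteq> q3" for s
    proof -
      have "P' = A @ C1 @ q3 # C2" using P'_eq C12 by simp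
      then show ?thesis using that dP by (cases C2 rule: rev_cases) auto
    qed
    \<comment> \<open>\<open>C1\<close> is the segment from \<open>q2\<close> to just before
      \<open>q3\<close>. It is empty if \<open>q2 = q3\<close>; otherwise \<open>tl\<close> drops
      \<open>q2\<close>, which is the end of the path and not an inner vertex.\<close>
    define l3 where "l3 = (if C1 = [] then [s3] else s3 # q3 # rev (tl C1))"
    have w3: "walk E (p # l3 @ [q2])"
    proof (cases "C1 = []")
      case True
      then show ?thesis using e C12 by (simp add: l3_def)
    next
      case False
      then obtain D where D: "C1 = q2 # D" using C12 by (cases C1) auto
      have "walk E (q2 # D @ [q3])"
        using wP D C12 by (auto simp: P'_eq successively_append_iff successively_Cons hd_append)
      then have "walk E (rev (q2 # D @ [q3]))"
        unfolding successively_rev by (simp add: insert_commute)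
      then show ?thesis using e D by (simp add: l3_def)
    qed
    have "distinct (p # q2 # (s1 # A) @ [s2] @ l3)"
    proof (cases "C1 = []")
      case True
      then have "q3 = q2" using C12 by simp
      then show ?thesis
        using True dP n ne notin[OF l(1) n(2)] notin[OF l(2) n(4)] s2 s3 P'_eq by (auto simp: l3_def)
    next
      case False
      then obtain D where D: "C1 = q2 # D" using C12 by (cases C1) auto
      then show ?thesis
        using False C12 dP n ne notin[OF l(1) n(2)] notin[OF l(2) n(4)] s2 s3 P'_eq
        by (auto simp: l3_def)
    qed
    then show False
      using T w1 w2 w3 unfolding theta_free_def
      by (metis list.distinct(1) l3_def)
  qed
  have "2 \<le> card (nbrs E p - {s1})"
    using p3 s1 finite_nbrs[OF G] by auto
  then obtain s2 s3 where s23: "s2 \<in> nbrs E p - {s1}" "s3 \<in> nbrs E p - {s1}" "s2 \<noteq> s3"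
    by (auto simp: numeral_2_eq_2 card_le_Suc_iff)
  obtain q2 where q2: "nbrs E s2 = {p, q2}" "q2 \<noteq> p" "3 \<le> card (nbrs E q2)"
    using step s23 by blast
  obtain q3 where q3: "nbrs E s3 = {p, q3}" "q3 \<noteq> p" "3 \<le> card (nbrs E q3)"
    using step s23 by blast
  have in2: "q2 \<in> set P'" and in3: "q3 \<in> set P'" using ear s23 q2 q3 by auto
  obtain A C where AC: "P' = A @ q2 # C" using in2 by (meson split_list)
  show False
  proof (cases "q3 \<in> set (q2 # C)")
    case True
    then show False using key[OF AC _ _ _ q2 _ _ q3] s23 by auto
  next
    case False
    then have "q3 \<in> set A" using in3 AC by auto
    then obtain A1 A2 where "A = A1 @ q3 # A2" by (meson split_list)
    then have "P' = A1 @ q3 # (A2 @ q2 # C)" using AC by simp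
    then show False using key[OF _ _ _ _ q3 _ _ q2, of A1 "A2 @ q2 # C"] s23 by auto
  qed
qed

text \<open>All hypotheses pass to induced subgraphs on nonempty vertex sets, so the induction may
  delete any nonempty proper set of vertices. The cases are a vertex of degree at most one, two
  adjacent vertices of degree at most two, and two adjacent vertices of degree at least three; if
  none occurs, the degrees alternate.\<close>

theorem diamond_free_edge_bound:
  assumes "simple_graph (V, E)" "V \<noteq> {}" "S22_free E" "theta_free E" "diamond_free E"
  shows "2 * card E + 3 \<le> 3 * card V"
  using assms
proof (induction "card V" arbitrary: V E rule: less_induct)
  case less
  note G = less.prems(1) and S = less.prems(3) and D = less.prems(5)
  have finV: "finite V" using G by (simp add: simple_graph_def)
  have IH: "2 * card {e \<in> E. e \<inter> U = {}} + 3 \<le> 3 * card (V - U)"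
    if "U \<subseteq> V" "U \<noteq> {}" "U \<noteq> V" for U
  proof (rule less.hyps)
    show "card (V - U) < card V"
      using that finV by (intro psubset_card_mono) auto
  qed (use that less.prems simple_graph_restrict in
      \<open>auto intro: S22_free_mono theta_free_mono diamond_free_mono\<close>)
  show ?case
  proof (cases "\<forall>v\<in>V. 2 \<le> card (nbrs E v)")
    case False
    then obtain v where v: "v \<in> V" "card (nbrs E v) \<le> 1" by force
    then obtain w where w: "nbrs E v \<subseteq> {w}"
      by (metis One_nat_def card_le_Suc0_iff_eq finite_nbrs[OF G] insertI1 subsetI)
    show ?thesis
    proof (cases "V = {v}")
      case True
      then have "E = {}" using G by (auto simp: simple_graph_def subset_singleton_iff)
      then show ?thesis using True by simp
    next
      case False
      show ?thesis
        by (rule edge_bound_remove[OF G, of "{v}" "[{v,w}]"])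
          (use v w IH[of "{v}"] False in auto)
    qed
  next
    case deg: True
    show ?thesis
    proof (cases "\<exists>u v. v \<in> nbrs E u \<and> card (nbrs E u) \<le> 2 \<and> card (nbrs E v) \<le> 2")
      case True
      then obtain u v where uv: "v \<in> nbrs E u" "card (nbrs E u) \<le> 2" "card (nbrs E v) \<le> 2" by auto
      have c2: "\<exists>w. nbrs E t = {z, w} \<and> w \<noteq> z" if "z \<in> nbrs E t" "card (nbrs E t) \<le> 2" for z t
      proof -
        have "card (nbrs E t) = 2" using that deg nbrs_verts[OF G that(1)] by force
        then show ?thesis using that(1) by (auto simp: card_2_iff)
      qed
      have vu: "u \<in> nbrs E v" using uv nbrs_sym by metis
      obtain u' where u': "nbrs E u = {v, u'}" "u' \<noteq> v" using c2[OF uv(1,2)] by auto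
      obtain v' where v': "nbrs E v = {u, v'}" using c2[OF vu uv(3)] by auto
      \<comment> \<open>Three edges for two vertices. The vertex \<open>u'\<close> survives, so the
        rest is nonempty.\<close>
      have "u' \<in> V" "u' \<noteq> u" using nbrs_verts[OF G, of u' u] u' by auto
      then have "{u, v} \<noteq> V" using u' by auto
      show ?thesis
        by (rule edge_bound_remove[OF G, of "{u, v}" "[{u,v},{u,u'},{v,v'}]"])
          (use u' v' IH[of "{u, v}"] \<open>{u, v} \<noteq> V\<close> nbrs_verts[OF G uv(1)] in
            \<open>auto simp: insert_commute\<close>)
    next
      case no_small: False
      show ?thesis
      proof (cases "\<exists>u v. v \<in> nbrs E u \<and> 3 \<le> card (nbrs E u) \<and> 3 \<le> card (nbrs E v)")
        case True
        then show ?thesis using big_edge_bound[OF G S D _ _ _ _ IH] deg by blast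
      next
        case False
        then have "\<not> theta_free E"
          using no_small deg nbrs_verts[OF G]
          by (intro theta_of_alternating_degrees[OF G \<open>V \<noteq> {}\<close>])
            (metis eq_iff not_less_eq_eq numeral_2_eq_2 numeral_3_eq_3)+
        then show ?thesis using less.prems by simp
      qed
    qed
  qed
qed

subsection \<open>Graphs with diamonds\<close>

text \<open>
  Deleting vertices destroys connectedness, so the induction carries the following invariant
  instead. It survives the deletion of a diamond because the outer end of an exit has degree at most
  two and hence belongs to no other diamond.
\<close>

definition exits_single :: "'a set set \<Rightarrow> 'a set \<Rightarrow> bool" where
  "exits_single E W \<longleftrightarrow> (\<exists>s t. s \<in> W \<and> t \<notin> W \<and> t \<in> nbrs E s \<and> card (nbrs E t) \<le> 2 \<and>
     (\<forall>u\<in>W. nbrs E u \<subseteq> W \<or> u = s \<and> nbrs E u \<subseteq> insert t W))"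

text \<open>\<open>a\<close> and \<open>c\<close> are passed separately because the set
  \<open>W\<close> does not tell the tips of the diamond from its central edge.\<close>

definition exits_double :: "'a set set \<Rightarrow> 'a set \<Rightarrow> 'a \<Rightarrow> 'a \<Rightarrow> bool" where
  "exits_double E W a c \<longleftrightarrow> (\<exists>s t. s \<notin> W \<and> t \<notin> W \<and> s \<in> nbrs E a \<and> t \<in> nbrs E c \<and>
     card (nbrs E s) \<le> 2 \<and> card (nbrs E t) \<le> 2 \<and>
     (\<forall>u\<in>W. nbrs E u \<subseteq> W \<or> u = a \<and> nbrs E u \<subseteq> insert s W \<or> u = c \<and> nbrs E u \<subseteq> insert t W))"

definition open_diamonds :: "'a set set \<Rightarrow> bool" where
  "open_diamonds E \<longleftrightarrow> (\<forall>x y a c. diamond E x y a c \<longrightarrow>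
     exits_single E {x, y, a, c} \<or> exits_double E {x, y, a, c} a c)"

text \<open>A vertex of a diamond in \<open>E'\<close> has two neighbours there, so by
  \<open>same\<close> its neighbourhood is that in \<open>E\<close>. The exits of the diamond are
  therefore unchanged, and the degrees of their outer ends can only drop.\<close>

lemma open_diamonds_mono:
  assumes G: "simple_graph (V, E)" and O: "open_diamonds E" and sub: "E' \<subseteq> E"
    and same: "\<And>u. 2 \<le> card (nbrs E' u) \<Longrightarrow> nbrs E' u = nbrs E u"
  shows "open_diamonds E'"
  unfolding open_diamonds_def
proof (intro allI impI)
  fix x y a c assume D: "diamond E' x y a c"
  define W where "W = {x, y, a, c}"
  have aW: "a \<in> W" "c \<in> W" by (auto simp: W_def)
  have sub_nbrs: "nbrs E' u \<subseteq> nbrs E u" for u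
    using sub by (auto simp: nbrs_def)
  have fin: "finite (nbrs E' u)" for u
    using finite_nbrs[OF G] sub_nbrs by (rule finite_subset[rotated])
  have two: "2 \<le> card (nbrs E' u)" if "p \<in> nbrs E' u" "q \<in> nbrs E' u" "p \<noteq> q" for u p q
    using that card_mono[OF fin, of "{p, q}" u] by simp
  have eq: "nbrs E' u = nbrs E u" if "u \<in> W" for u
  proof -
    have "2 \<le> card (nbrs E' x)" "2 \<le> card (nbrs E' y)" "2 \<le> card (nbrs E' a)" "2 \<le> card (nbrs E' c)"
      using D two[of y x a] two[of x y a] two[of x a y] two[of x c y]
      by (auto simp: diamond_def nbrs_def insert_commute)
    then show ?thesis using that same by (auto simp: W_def)
  qed
  have le: "card (nbrs E' t) \<le> card (nbrs E t)" for t
    using sub_nbrs finite_nbrs[OF G] by (intro card_mono) auto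
  have "exits_single E W \<or> exits_double E W a c"
    using O diamond_mono[OF D sub] unfolding open_diamonds_def W_def by blast
  then have "exits_single E' W \<or> exits_double E' W a c"
  proof
    assume "exits_single E W"
    then obtain s t where "s \<in> W" "t \<notin> W" "t \<in> nbrs E s" "card (nbrs E t) \<le> 2"
      "\<forall>u\<in>W. nbrs E u \<subseteq> W \<or> u = s \<and> nbrs E u \<subseteq> insert t W"
      unfolding exits_single_def by blast
    then have "exits_single E' W"
      unfolding exits_single_def using eq le[of t] by (intro exI[of _ s] exI[of _ t]) auto
    then show ?thesis ..
  next
    assume "exits_double E W a c"
    then obtain s t where "s \<notin> W" "t \<notin> W" "s \<in> nbrs E a" "t \<in> nbrs E c"
      "card (nbrs E s) \<le> 2" "card (nbrs E t) \<le> 2"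
      "\<forall>u\<in>W. nbrs E u \<subseteq> W \<or> u = a \<and> nbrs E u \<subseteq> insert s W \<or> u = c \<and> nbrs E u \<subseteq> insert t W"
      unfolding exits_double_def by blast
    then have "exits_double E' W a c"
      unfolding exits_double_def using eq[of a] eq[of c] eq le[of t] le[of s]
      by (intro exI[of _ s] exI[of _ t]) (auto simp: aW)
    then show ?thesis ..
  qed
  then show "exits_single E' {x, y, a, c} \<or> exits_double E' {x, y, a, c} a c"
    by (simp add: W_def)
qed

lemma rtrancl_path:
  assumes "(s, t) \<in> {(a, b). {a, b} \<in> E}\<^sup>*"
  shows "\<exists>xs. xs \<noteq> [] \<and> distinct xs \<and> walk E xs \<and> hd xs = s \<and> last xs = t \<and> set xs \<subseteq> insert s (\<Union>E)"
  using assms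
proof (induction rule: rtrancl_induct)
  case base
  then show ?case by (intro exI[of _ "[s]"]) auto
next
  case (step y z)
  then obtain xs where xs: "xs \<noteq> []" "distinct xs" "walk E xs" "hd xs = s" "last xs = y"
    "set xs \<subseteq> insert s (\<Union>E)" by blast
  show ?case
  proof (cases "z \<in> set xs")
    case True
    then obtain A B where "xs = A @ z # B" by (meson split_list)
    then show ?thesis
      using xs by (intro exI[of _ "A @ [z]"])
        (auto simp: successively_append_iff successively_Cons hd_append)
  next
    case False
    then show ?thesis
      using xs step by (intro exI[of _ "xs @ [z]"]) (auto simp: successively_append_iff)
  qed
qed

text \<open>A path from \<open>s\<close> to \<open>t\<close> in \<open>E'\<close> avoids the diamond
  and would be a third connection of the tips besides those through \<open>x\<close> and
  \<open>y\<close>. The reflexive closure also covers \<open>s = t\<close>, so the two exits have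
  different outer ends.\<close>

lemma theta_free_exits_separated:
  assumes T: "theta_free E" and D: "diamond E x y a c" and "E' \<subseteq> E"
    and W: "\<Union>E' \<inter> {x, y, a, c} = {}" "s \<notin> {x, y, a, c}"
    and st: "s \<in> nbrs E a" "t \<in> nbrs E c"
  shows "(s, t) \<notin> {(a, b). {a, b} \<in> E'}\<^sup>*"
proof
  assume "(s, t) \<in> {(a, b). {a, b} \<in> E'}\<^sup>*"
  then obtain xs where xs: "xs \<noteq> []" "distinct xs" "walk E' xs" "hd xs = s" "last xs = t"
    "set xs \<subseteq> insert s (\<Union>E')"
    using rtrancl_path by metis
  have "walk E xs" using xs(3) \<open>E' \<subseteq> E\<close> by (auto intro: successively_mono)
  then have "walk E (a # xs @ [c])"
    using st xs by (auto simp: successively_append_iff successively_Cons nbrs_def insert_commute)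
  moreover have "walk E (a # [x] @ [c])" "walk E (a # [y] @ [c])"
    using D by (auto simp: diamond_def insert_commute)
  moreover have "distinct (a # c # [x] @ [y] @ xs)"
    using D W xs by (auto simp: diamond_def)
  ultimately show False
    using T xs(1) unfolding theta_free_def by blast
qed

text \<open>A diamond with one exit is deleted as four vertices with six edges. With two exits seven
  edges disappear, one too many, but the rest splits into two parts, each satisfying the bound with
  its own summand 3.\<close>

theorem open_diamonds_edge_bound:
  assumes "simple_graph (V, E)" "V \<noteq> {}" "S22_free E" "theta_free E" "open_diamonds E" "K4_free E"
  shows "2 * card E + 3 \<le> 3 * card V"
  using assms
proof (induction "card V" arbitrary: V E rule: less_induct)
  case less
  note G = less.prems(1)
  show ?case
  proof (cases "diamond_free E")
    case True
    then show ?thesis using diamond_free_edge_bound less.prems by blast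
  next
    case False
    then obtain x y a c where D: "diamond E x y a c" by (auto simp: diamond_free_def)
    define W where "W = {x, y, a, c}"
    have cW: "card W = 4" using D by (auto simp: W_def diamond_def)
    have e: "{x, y} \<in> E" "{x, a} \<in> E" "{x, c} \<in> E" "{y, a} \<in> E" "{y, c} \<in> E"
      using D by (auto simp: diamond_def)
    have WV: "W \<subseteq> V" using G e by (auto simp: W_def simple_graph_def)
    \<comment> \<open>With no K_4, \<open>W\<close> spans only five edges.\<close>
    have ac: "{a, c} \<notin> E"
    proof
      assume "{a, c} \<in> E"
      then have "{{x, y}, {x, a}, {x, c}, {y, a}, {y, c}, {a, c}} \<subseteq> E" using e by simp
      moreover have "distinct [x, y, a, c]" using D by (simp add: diamond_def)
      ultimately show False
        using less.prems(6)[unfolded K4_free_def, rule_format, of x y a c] by blast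
    qed
    define F where "F = [{x,y},{x,a},{x,c},{y,a},{y,c}]"
    have inF: "{u, v} \<in> set F" if "u \<in> W" "v \<in> W" "{u, v} \<in> E" for u v
    proof -
      have "u = x \<or> u = y \<or> u = a \<or> u = c" "v = x \<or> v = y \<or> v = a \<or> v = c"
        using that by (auto simp: W_def)
      moreover have "u \<noteq> v" "{u, v} \<noteq> {a, c}"
        using that(3) ac singleton_not_edge[OF G] by auto
      ultimately have "{u, v} = {x, y} \<or> {u, v} = {x, a} \<or> {u, v} = {x, c} \<or>
          {u, v} = {y, a} \<or> {u, v} = {y, c}"
        unfolding doubleton_eq_iff by metis
      then show ?thesis unfolding F_def by (simp only: list.set insert_iff) simp
    qed
    let ?E = "{e \<in> E. e \<inter> W = {}}"
    have nE: "nbrs ?E u = (if u \<in> W then {} else nbrs E u - W)" for u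
      by (auto simp: nbrs_def)
    have out: "nbrs E u \<inter> W = {}" if "u \<notin> W" "\<forall>w\<in>W. u \<notin> nbrs E w" for u
      using that nbrs_sym[of _ E u] by auto
    have leaf: "card (nbrs ?E t) \<le> 1" if "t \<in> nbrs E s" "s \<in> W" "card (nbrs E t) \<le> 2" for s t
    proof -
      have "nbrs ?E t \<subseteq> nbrs E t - {s}" using that nE by auto
      then have "card (nbrs ?E t) \<le> card (nbrs E t - {s})"
        using finite_nbrs[OF G] by (intro card_mono) auto
      then show ?thesis
        using that finite_nbrs[OF G, of t] nbrs_sym[of s E t] by (simp add: card_Diff_singleton)
    qed
    \<comment> \<open>Besides \<open>W\<close> itself, only neighbours of \<open>W\<close> lose
      edges. If each of them keeps at most one neighbour, then every vertex with two neighbours left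
      is unaffected, as \<open>open_diamonds_mono\<close> demands.\<close>
    have open': "open_diamonds ?E"
      if "\<And>u. u \<notin> W \<Longrightarrow> nbrs E u \<inter> W \<noteq> {} \<Longrightarrow> card (nbrs ?E u) \<le> 1"
    proof (rule open_diamonds_mono[OF G less.prems(5)])
      fix u assume "2 \<le> card (nbrs ?E u)"
      then show "nbrs ?E u = nbrs E u"
        using that[of u] nE[of u] by (cases "u \<in> W") auto
    qed auto
    have "exits_single E W \<or> exits_double E W a c"
      using less.prems(5) D by (auto simp: open_diamonds_def W_def)
    then show ?thesis
    proof
      assume "exits_single E W"
      then obtain s t where st: "s \<in> W" "t \<notin> W" "t \<in> nbrs E s" "card (nbrs E t) \<le> 2"
        "\<And>u. u \<in> W \<Longrightarrow> nbrs E u \<subseteq> W \<or> u = s \<and> nbrs E u \<subseteq> insert t W"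
        unfolding exits_single_def by blast
      have tV: "t \<in> V" using nbrs_verts[OF G st(3)] by simp
      show ?thesis
      proof (rule edge_bound_remove[OF G WV, of "F @ [{s, t}]"])
        show "2 * card ?E + 3 \<le> 3 * card (V - W)"
        proof (rule less.hyps)
          have "V - W \<subset> V" using WV by (auto simp: W_def)
          then show "card (V - W) < card V"
            using G by (intro psubset_card_mono) (auto simp: simple_graph_def)
          show "open_diamonds ?E"
          proof (rule open')
            fix u assume u: "u \<notin> W" "nbrs E u \<inter> W \<noteq> {}"
            then obtain w where "w \<in> W" "u \<in> nbrs E w" using out by blast
            then have "u = t" using u st(5) by blast
            then show "card (nbrs ?E u) \<le> 1" using leaf st by blast
          qed
        qed (use less.prems simple_graph_restrict tV st in
            \<open>auto intro: S22_free_mono theta_free_mono K4_free_mono\<close>)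
        show "{u, w} \<in> set (F @ [{s, t}])" if "u \<in> W" "w \<in> nbrs E u" for u w
          using that st(5)[of u] inF[of u w] by (auto simp: nbrs_iff)
      qed (use cW in \<open>auto simp: F_def\<close>)
    next
      assume "exits_double E W a c"
      then obtain s t where st: "s \<notin> W" "t \<notin> W" "s \<in> nbrs E a" "t \<in> nbrs E c"
        "card (nbrs E s) \<le> 2" "card (nbrs E t) \<le> 2"
        "\<And>u. u \<in> W \<Longrightarrow> nbrs E u \<subseteq> W \<or> u = a \<and> nbrs E u \<subseteq> insert s W \<or> u = c \<and> nbrs E u \<subseteq> insert t W"
        unfolding exits_double_def by blast
      have stV: "s \<in> V" "t \<in> V" using nbrs_verts[OF G] st by blast+
      let ?r = "{(u, v). {u, v} \<in> ?E}"
      \<comment> \<open>\<open>R\<close> is the component of \<open>s\<close> after the deletion of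
        \<open>W\<close>. It does not contain \<open>t\<close>, so \<open>V1\<close> and
        \<open>V2\<close> are both nonempty.\<close>
      define R where "R = {v. (s, v) \<in> ?r\<^sup>*}"
      have tR: "t \<notin> R"
        using theta_free_exits_separated[OF less.prems(4) D, of ?E s t] st
        by (auto simp: R_def W_def)
      have sR: "s \<in> R" by (simp add: R_def)
      have Rstep: "v \<in> R" if "u \<in> R" "{u, v} \<in> ?E" for u v
        using that unfolding R_def by (auto intro: rtrancl_into_rtrancl)
      have "v \<in> V - W" if "(s, v) \<in> ?r\<^sup>*" for v
        using that
      proof (induction rule: rtrancl_induct)
        case (step y z)
        then have "{y, z} \<in> ?E" by simp
        then show ?case using G by (auto simp: simple_graph_def)
      qed (use stV st in auto)
      then have RV: "R \<subseteq> V - W" unfolding R_def by blast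
      define V1 V2 where "V1 = R" and "V2 = V - W - R"
      define E1 E2 where "E1 = {e \<in> ?E. e \<subseteq> V1}" and "E2 = {e \<in> ?E. e \<subseteq> V2}"
      have G': "simple_graph (V - W, ?E)" using simple_graph_restrict[OF G] .
      have cover: "?E = E1 \<union> E2"
      proof -
        have "e \<subseteq> V1 \<or> e \<subseteq> V2" if e: "e \<in> ?E" for e
        proof -
          obtain p q where "e = {p, q}"
            using G' e by (metis (no_types, lifting) card_2_iff simple_graph_def snd_conv)
          moreover from this have "p \<in> V - W" "q \<in> V - W" using G' e by (auto simp: simple_graph_def)
          ultimately show ?thesis
            using Rstep[of p q] Rstep[of q p] e by (auto simp: V1_def V2_def insert_commute)
        qed
        then show ?thesis by (auto simp: E1_def E2_def)
      qed
      have open_E: "open_diamonds ?E"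
      proof (rule open')
        fix u assume u: "u \<notin> W" "nbrs E u \<inter> W \<noteq> {}"
        then obtain w where "w \<in> W" "u \<in> nbrs E w" using out by blast
        then have "u = s \<or> u = t" using u st(7) by blast
        then show "card (nbrs ?E u) \<le> 1" using leaf[of s a] leaf[of t c] st by (auto simp: W_def)
      qed
      \<comment> \<open>No remaining edge joins \<open>U\<close> to its complement, so the vertices
        of \<open>U\<close> keep their neighbourhoods and the invariant passes to the part.\<close>
      have part: "2 * card {e \<in> ?E. e \<subseteq> U} + 3 \<le> 3 * card U"
        if U: "U \<subseteq> V - W" "U \<noteq> {}" and closed: "\<And>e. e \<in> ?E \<Longrightarrow> e \<inter> U \<noteq> {} \<Longrightarrow> e \<subseteq> U" for U
      proof (rule less.hyps)
        have "U \<subset> V" using U WV by (auto simp: W_def)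
        then show "card U < card V"
          using G by (intro psubset_card_mono) (auto simp: simple_graph_def)
        show "simple_graph (U, {e \<in> ?E. e \<subseteq> U})"
          using G U WV finite_subset[of U V] by (auto simp: simple_graph_def)
        show "open_diamonds {e \<in> ?E. e \<subseteq> U}"
        proof (rule open_diamonds_mono[OF G' open_E])
          fix u assume "2 \<le> card (nbrs {e \<in> ?E. e \<subseteq> U} u)"
          then have "nbrs {e \<in> ?E. e \<subseteq> U} u \<noteq> {}" by auto
          then have "u \<in> U" by (auto simp: nbrs_def)
          then show "nbrs {e \<in> ?E. e \<subseteq> U} u = nbrs ?E u"
            using closed by (auto simp: nbrs_def)
        qed auto
      qed (use less.prems U in \<open>auto intro: S22_free_mono theta_free_mono K4_free_mono\<close>)
      have "2 * card E1 + 3 \<le> 3 * card V1"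
        unfolding E1_def using cover RV sR by (intro part) (auto simp: V1_def V2_def E1_def E2_def)
      moreover have "2 * card E2 + 3 \<le> 3 * card V2"
        unfolding E2_def using cover tR stV st by (intro part) (auto simp: V1_def V2_def E1_def E2_def)
      moreover have "card ?E \<le> card E1 + card E2"
        unfolding cover by (rule card_Un_le)
      \<comment> \<open>The seven deleted edges weigh 14 against 12 for four vertices; the excess 2
        is covered by the additional 3 of the second part.\<close>
      moreover have "card E \<le> card ?E + length (F @ [{a, s}, {c, t}])"
      proof (rule card_edges_remove[OF G])
        show "{u, w} \<in> set (F @ [{a, s}, {c, t}])" if "u \<in> W" "w \<in> nbrs E u" for u w
          using that st(7)[of u] inF[of u w] by (auto simp: nbrs_iff)
      qed
      moreover have "card V = card V1 + card V2 + card W"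
      proof -
        have "finite V" using G by (simp add: simple_graph_def)
        moreover have "V = V1 \<union> V2 \<union> W" using RV WV by (auto simp: V1_def V2_def)
        moreover have "V1 \<inter> V2 = {}" "(V1 \<union> V2) \<inter> W = {}" using RV by (auto simp: V1_def V2_def)
        ultimately show ?thesis by (metis card_Un_disjoint finite_Un)
      qed
      ultimately show ?thesis using cW by (simp add: F_def)
    qed
  qed
qed

section \<open>Exits of diamonds in connected graphs\<close>

lemma connected_graph_exit:
  assumes C: "connected_graph (V, E)" and W: "W \<subseteq> V" "W \<noteq> {}" "W \<noteq> V"
  shows "\<exists>u\<in>W. \<exists>w. w \<in> nbrs E u \<and> w \<notin> W"
proof (rule ccontr)
  assume closed: "\<not> ?thesis"
  obtain u v where uv: "u \<in> W" "v \<in> V" "v \<notin> W" using W by auto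
  then have "(u, v) \<in> {(a, b). {a, b} \<in> E}\<^sup>*"
    using C W by (auto simp: connected_graph_def)
  then have "v \<in> W"
  proof (induction rule: rtrancl_induct)
    case (step y z)
    then show ?case using closed by (auto simp: nbrs_def)
  qed (rule uv)
  then show False using uv by simp
qed

lemma card_nbrs_le_2:
  assumes "nbrs E v \<subseteq> {p, q}"
  shows "card (nbrs E v) \<le> 2"
  using card_mono[OF _ assms] by (auto simp: card_insert_if split: if_splits)

lemma S22_free_nbrsD:
  assumes "S22_free E" "q \<in> nbrs E p" "r \<in> nbrs E p" "s \<in> nbrs E p" "t \<in> nbrs E q" "u \<in> nbrs E q"
    "distinct [p, q, r, s, t, u]"
  shows False
  using assms S22_freeD[of E p q r s t u] by (simp add: nbrs_iff)

lemma diamond_nbrs: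
  assumes "diamond E x y a c"
  shows "y \<in> nbrs E x" "x \<in> nbrs E y" "a \<in> nbrs E x" "a \<in> nbrs E y" "c \<in> nbrs E x" "c \<in> nbrs E y"
    "x \<in> nbrs E a" "y \<in> nbrs E a" "x \<in> nbrs E c" "y \<in> nbrs E c" "distinct [x, y, a, c]"
  using assms by (auto simp: diamond_def nbrs_def insert_commute)

lemma theta_free_diamond:
  assumes T: "theta_free E" and D: "diamond E x y a c" and b: "b \<in> nbrs E x" "b \<notin> {x, y, a, c}"
  shows "b \<notin> nbrs E y"
proof
  assume "b \<in> nbrs E y"
  then have "walk E (x # [b] @ [y])" "walk E (x # [a] @ [y])" "walk E (x # [c] @ [y])"
    using b D by (auto simp: diamond_def nbrs_def insert_commute)
  moreover have "distinct (x # y # [b] @ [a] @ [c])"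
    using b D by (auto simp: diamond_def)
  ultimately show False using T unfolding theta_free_def by blast
qed

text \<open>A further neighbour \<open>z\<close> of \<open>y\<close> gives a double star with leaves
  \<open>a\<close>, \<open>b\<close> at \<open>x\<close> and \<open>c\<close>, \<open>z\<close> at
  \<open>y\<close>; a further neighbour \<open>z\<close> of \<open>x\<close> gives one with leaves
  \<open>z\<close>, \<open>b\<close> at \<open>x\<close> and \<open>a\<close>, \<open>c\<close> at
  \<open>y\<close>.\<close>

lemma diamond_end_exit:
  assumes G: "simple_graph (V, E)" and S: "S22_free E" and T: "theta_free E"
    and D: "diamond E x y a c" and b: "b \<in> nbrs E x" "b \<notin> {x, y, a, c}"
  shows "nbrs E y \<subseteq> {x, a, c}" "nbrs E x \<subseteq> {y, a, c, b}"
proof -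
  note n = diamond_nbrs[OF D]
  show "nbrs E y \<subseteq> {x, a, c}"
  proof
    fix z assume z: "z \<in> nbrs E y"
    have "z \<noteq> y" "z \<noteq> b"
      using z theta_free_diamond[OF T D b] not_nbrs_self[OF G, of y] by auto
    then show "z \<in> {x, a, c}"
      using S22_free_nbrsD[OF S n(1) n(3) b(1) n(6) z] n(11) b(2) by auto
  qed
  show "nbrs E x \<subseteq> {y, a, c, b}"
  proof
    fix z assume z: "z \<in> nbrs E x"
    have "z \<noteq> x"
      using z not_nbrs_self[OF G, of x] by auto
    then show "z \<in> {y, a, c, b}"
      using S22_free_nbrsD[OF S n(1) z b(1) n(4,6)] n(11) b(2) by auto
  qed
qed

text \<open>If \<open>b\<close> were adjacent to \<open>a\<close>, every edge leaving the five
  vertices \<open>x\<close>, \<open>y\<close>, \<open>a\<close>, \<open>c\<close>, \<open>b\<close>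
  would complete a double star. A connected graph on six or more vertices has such an edge.\<close>

lemma diamond_exit_nonadjacent:
  assumes G: "simple_graph (V, E)" and C: "connected_graph (V, E)" and V: "6 \<le> card V"
    and S: "S22_free E" and T: "theta_free E"
    and D: "diamond E x y a c" and b: "b \<in> nbrs E x" "b \<notin> {x, y, a, c}"
  shows "b \<notin> nbrs E a"
proof
  assume ba: "b \<in> nbrs E a"
  note n = diamond_nbrs[OF D]
  note e = diamond_end_exit[OF G S T D b]
  have ab: "a \<in> nbrs E b" and xb: "x \<in> nbrs E b" using ba b nbrs_sym by metis+
  have by_: "y \<notin> nbrs E b" using e(1) b nbrs_sym[of y E b] by auto
  have na: "nbrs E a \<subseteq> {x, y, b, c}"
  proof
    fix z assume z: "z \<in> nbrs E a"
    have "z \<noteq> a" using z not_nbrs_self[OF G, of a] by auto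
    then show "z \<in> {x, y, b, c}"
      using S22_free_nbrsD[OF S n(7) n(8) z b(1) n(5)] n(11) b(2) by auto
  qed
  have nc: "nbrs E c \<subseteq> {x, y, b, a}"
  proof
    fix z assume z: "z \<in> nbrs E c"
    have "z \<noteq> c" using z not_nbrs_self[OF G, of c] by auto
    then show "z \<in> {x, y, b, a}"
      using S22_free_nbrsD[OF S n(9) n(10) z b(1) n(3)] n(11) b(2) by auto
  qed
  have nb: "nbrs E b \<subseteq> {x, a, c}"
  proof
    fix z assume z: "z \<in> nbrs E b"
    have "z \<noteq> b" "z \<noteq> y" using z by_ not_nbrs_self[OF G, of b] by auto
    then show "z \<in> {x, a, c}"
      using S22_free_nbrsD[OF S xb ab z n(1) n(5)] n(11) b(2) by auto
  qed
  let ?W = "{x, y, a, c, b}"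
  have "card ?W \<le> 5" using card_length[of "[x, y, a, c, b]"] by simp
  then have "?W \<noteq> V" using V by auto
  moreover have "?W \<subseteq> V"
    using nbrs_verts[OF G b(1)] nbrs_verts[OF G n(1)] nbrs_verts[OF G n(3)] nbrs_verts[OF G n(5)] by auto
  ultimately obtain u w where "u \<in> ?W" "w \<in> nbrs E u" "w \<notin> ?W"
    using connected_graph_exit[OF C, of ?W] by blast
  then show False using e na nc nb by blast
qed

lemma diamond_commute: "diamond E x y a c \<Longrightarrow> diamond E x y c a" "diamond E x y a c \<Longrightarrow> diamond E y x a c"
  by (auto simp: diamond_def insert_commute)

text \<open>The outer end \<open>b\<close> is adjacent to none of \<open>y\<close>,
  \<open>a\<close>, \<open>c\<close>, so \<open>S22_free_pendant\<close> bounds its degree. An exit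
  at \<open>a\<close> or \<open>c\<close> would give a double star with central edge
  \<open>{a, x}\<close> or \<open>{c, x}\<close> and \<open>b\<close> as a leaf at
  \<open>x\<close>.\<close>

lemma diamond_end_exits_single:
  assumes G: "simple_graph (V, E)" and C: "connected_graph (V, E)" and V: "6 \<le> card V"
    and S: "S22_free E" and T: "theta_free E"
    and D: "diamond E x y a c" and b: "b \<in> nbrs E x" "b \<notin> {x, y, a, c}"
  shows "exits_single E {x, y, a, c}"
proof -
  note n = diamond_nbrs[OF D]
  note e = diamond_end_exit[OF G S T D b]
  have ba: "b \<notin> nbrs E a" using diamond_exit_nonadjacent[OF G C V S T D b] .
  have bc: "b \<notin> nbrs E c"
    using diamond_exit_nonadjacent[OF G C V S T diamond_commute(1)[OF D] b(1)] b(2) by auto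
  have na: "nbrs E a \<subseteq> {x, y, c}"
  proof
    fix z assume z: "z \<in> nbrs E a"
    have "z \<noteq> a" "z \<noteq> b" using z ba not_nbrs_self[OF G, of a] by auto
    then show "z \<in> {x, y, c}"
      using S22_free_nbrsD[OF S n(7) n(8) z b(1) n(5)] n(11) b(2) by auto
  qed
  have nc: "nbrs E c \<subseteq> {x, y, a}"
  proof
    fix z assume z: "z \<in> nbrs E c"
    have "z \<noteq> c" "z \<noteq> b" using z bc not_nbrs_self[OF G, of c] by auto
    then show "z \<in> {x, y, a}"
      using S22_free_nbrsD[OF S n(9) n(10) z b(1) n(3)] n(11) b(2) by auto
  qed
  have "y \<notin> nbrs E b" "a \<notin> nbrs E b" "x \<in> nbrs E b"
    using e(1) ba b nbrs_sym[of _ E b] by auto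
  then obtain w where "nbrs E b \<subseteq> {x, w}"
    using S22_free_pendant[OF G S, of x b y a] n b by auto
  then have "card (nbrs E b) \<le> 2" by (rule card_nbrs_le_2)
  moreover have "\<forall>u\<in>{x, y, a, c}. nbrs E u \<subseteq> {x, y, a, c} \<or> u = x \<and> nbrs E u \<subseteq> insert b {x, y, a, c}"
    using e na nc by blast
  ultimately show ?thesis
    unfolding exits_single_def using b by (intro exI[of _ x] exI[of _ b]) simp
qed

text \<open>Two exits at \<open>a\<close> would complete a double star with central edge
  \<open>{a, x}\<close> and leaves \<open>y\<close>, \<open>c\<close> at \<open>x\<close>. The outer
  end of an exit is adjacent to neither \<open>x\<close> nor \<open>y\<close>, so
  \<open>S22_free_pendant\<close> bounds its degree.\<close>

lemma diamond_side_exit: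
  assumes G: "simple_graph (V, E)" and S: "S22_free E" and K: "K4_free E"
    and D: "diamond E x y a c" and n: "nbrs E x = {y, a, c}" "nbrs E y = {x, a, c}"
  shows "nbrs E a \<subseteq> {x, y, a, c} \<or>
    (\<exists>s. s \<in> nbrs E a \<and> s \<notin> {x, y, a, c} \<and> nbrs E a \<subseteq> insert s {x, y, a, c} \<and> card (nbrs E s) \<le> 2)"
proof (cases "nbrs E a \<subseteq> {x, y, a, c}")
  case False
  then obtain s where s: "s \<in> nbrs E a" "s \<notin> {x, y, a, c}" by blast
  note d = diamond_nbrs[OF D]
  have "nbrs E a \<subseteq> insert s {x, y, a, c}"
  proof
    fix z assume z: "z \<in> nbrs E a"
    show "z \<in> insert s {x, y, a, c}"
      using S22_free_nbrsD[OF S d(7) s(1) z d(1) d(5)] d(11) s(2) by auto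
  qed
  moreover have "x \<notin> nbrs E s" "y \<notin> nbrs E s" "a \<in> nbrs E s"
    using s n nbrs_sym[of _ E s] by auto
  then obtain w where "nbrs E s \<subseteq> {a, w}"
    using S22_free_pendant[OF G S, of a s x y] d s by auto
  then have "card (nbrs E s) \<le> 2" by (rule card_nbrs_le_2)
  ultimately show ?thesis using s by blast
qed simp

text \<open>An exit at \<open>x\<close> or \<open>y\<close> is the only one. Otherwise each tip has
  at most one exit, and connectedness on at least six vertices provides an exit at some tip.\<close>

lemma connected_open_diamonds:
  assumes G: "simple_graph (V, E)" and C: "connected_graph (V, E)" and V: "6 \<le> card V"
    and S: "S22_free E" and T: "theta_free E" and K: "K4_free E"
  shows "open_diamonds E"
  unfolding open_diamonds_def
proof (intro allI impI)
  fix x y a c assume D: "diamond E x y a c"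
  let ?W = "{x, y, a, c}"
  have swap: "{y, x, a, c} = ?W" "{x, y, c, a} = ?W" by auto
  note d = diamond_nbrs[OF D]
  show "exits_single E ?W \<or> exits_double E ?W a c"
  proof (cases "nbrs E x \<subseteq> ?W \<and> nbrs E y \<subseteq> ?W")
    case False
    then show ?thesis
      using diamond_end_exits_single[OF G C V S T D]
        diamond_end_exits_single[OF G C V S T diamond_commute(2)[OF D]] unfolding swap by blast
  next
    case True
    then have n: "nbrs E x = {y, a, c}" "nbrs E y = {x, a, c}"
      using d not_nbrs_self[OF G, of x] not_nbrs_self[OF G, of y] by auto
    have n': "nbrs E x = {y, c, a}" "nbrs E y = {x, c, a}" using n by auto
    note a = diamond_side_exit[OF G S K D n]
    note c = diamond_side_exit[OF G S K diamond_commute(1)[OF D] n', unfolded swap]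
    have "card ?W \<le> 4" using card_length[of "[x, y, a, c]"] by simp
    then have "?W \<noteq> V" using V by auto
    moreover have "?W \<subseteq> V"
      using nbrs_verts[OF G d(1)] nbrs_verts[OF G d(3)] nbrs_verts[OF G d(5)] by auto
    ultimately obtain u w where uw: "u \<in> ?W" "w \<in> nbrs E u" "w \<notin> ?W"
      using connected_graph_exit[OF C, of ?W] by blast
    show ?thesis
    proof (cases "nbrs E a \<subseteq> ?W")
      case aW: True
      then have "\<not> nbrs E c \<subseteq> ?W" using uw n by blast
      then obtain t where "t \<in> nbrs E c" "t \<notin> ?W" "nbrs E c \<subseteq> insert t ?W" "card (nbrs E t) \<le> 2"
        using c by blast
      moreover have "\<forall>u\<in>?W. nbrs E u \<subseteq> ?W \<or> u = c \<and> nbrs E u \<subseteq> insert t ?W"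
        using calculation(3) aW True by blast
      ultimately have "exits_single E ?W"
        unfolding exits_single_def by (intro exI[of _ c] exI[of _ t]) simp
      then show ?thesis ..
    next
      case aW: False
      then obtain s where s: "s \<in> nbrs E a" "s \<notin> ?W" "nbrs E a \<subseteq> insert s ?W" "card (nbrs E s) \<le> 2"
        using a by blast
      show ?thesis
      proof (cases "nbrs E c \<subseteq> ?W")
        case cW: True
        have "\<forall>u\<in>?W. nbrs E u \<subseteq> ?W \<or> u = a \<and> nbrs E u \<subseteq> insert s ?W"
          using s(3) cW True by blast
        then have "exits_single E ?W"
          unfolding exits_single_def using s by (intro exI[of _ a] exI[of _ s]) simp
        then show ?thesis ..
      next
        case False
        then obtain t where t: "t \<in> nbrs E c" "t \<notin> ?W" "nbrs E c \<subseteq> insert t ?W" "card (nbrs E t) \<le> 2"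
          using c by blast
        have "\<forall>u\<in>?W. nbrs E u \<subseteq> ?W \<or> u = a \<and> nbrs E u \<subseteq> insert s ?W \<or> u = c \<and> nbrs E u \<subseteq> insert t ?W"
          using s(3) t(3) True by blast
        then have "exits_double E ?W a c"
          unfolding exits_double_def using s t by (intro exI[of _ s] exI[of _ t]) simp
        then show ?thesis ..
      qed
    qed
  qed
qed

theorem S22_free_edge_bound:
  assumes "simple_graph (V, E)" "connected_graph (V, E)" "6 \<le> card V"
    "S22_free E" "theta_free E" "K4_free E"
  shows "2 * card E + 3 \<le> 3 * card V"
  using open_diamonds_edge_bound connected_open_diamonds assms
  by (metis card.empty not_numeral_le_zero)

subsection \<open>Theta curves in the plane\<close>

lemma K4_freeI:
  assumes "\<And>a b c d. distinct [a, b, c, d] \<Longrightarrow> {a, b} \<in> E \<Longrightarrow> {a, c} \<in> E \<Longrightarrow> {a, d} \<in> E \<Longrightarrow>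
    {b, c} \<in> E \<Longrightarrow> {b, d} \<in> E \<Longrightarrow> {c, d} \<in> E \<Longrightarrow> False"
  shows "K4_free E"
  unfolding K4_free_def using assms by (meson insert_subset)

text \<open>Since \<open>T \<subseteq> S\<close>, the point \<open>p\<close> is a limit of points
  outside \<open>T\<close>, whereas \<open>inside T\<close> is open and disjoint from
  \<open>outside T\<close>. Applied to cycles, this keeps the vertices of an outerplanar drawing out
  of their insides.\<close>

lemma frontier_outside_not_inside:
  fixes S T :: "'a::real_normed_vector set"
  assumes T: "closed T" "T \<subseteq> S" and p: "p \<in> frontier (outside S)"
  shows "p \<notin> inside T"
proof
  assume "p \<in> inside T"
  moreover have "open (inside T)" using T(1) by (rule open_inside)
  moreover have "p \<in> closure (outside T)"
    using p closure_mono[OF outside_mono[OF T(2)]] by (auto simp: frontier_def)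
  ultimately have "inside T \<inter> outside T \<noteq> {}"
    by (metis IntI open_Int_closure_eq_empty empty_iff)
  then show False by simp
qed

text \<open>If no arc ran inside the curve formed by the other two, \<open>inside J23\<close> would
  lie outside \<open>J12\<close> and outside \<open>J13\<close>. As \<open>J12 \<inter> J13\<close>
  is the connected arc \<open>c1\<close>, Janiszewski's theorem would join a point of
  \<open>inside J23\<close> to a far point while avoiding all three arcs.\<close>

lemma theta_curve_inside:
  fixes c1 c2 c3 :: "real \<Rightarrow> complex"
  assumes arcs: "arc c1" "arc c2" "arc c3"
    and start: "pathstart c1 = a" "pathstart c2 = a" "pathstart c3 = a"
    and finish: "pathfinish c1 = b" "pathfinish c2 = b" "pathfinish c3 = b"
    and int: "path_image c1 \<inter> path_image c2 = {a, b}" "path_image c1 \<inter> path_image c3 = {a, b}"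
      "path_image c2 \<inter> path_image c3 = {a, b}"
    and p1: "p1 \<in> path_image c1 - {a, b}" "p1 \<notin> inside (path_image c2 \<union> path_image c3)"
    and p2: "p2 \<in> path_image c2 - {a, b}" "p2 \<notin> inside (path_image c1 \<union> path_image c3)"
    and p3: "p3 \<in> path_image c3 - {a, b}"
  shows "p3 \<in> inside (path_image c1 \<union> path_image c2)"
proof (rule ccontr)
  assume p3_out: "p3 \<notin> inside (path_image c1 \<union> path_image c2)"
  have jordan: "inside J \<noteq> {} \<and> connected (inside J) \<and> connected (outside J) \<and> closed J \<and> bounded J \<and>
      frontier (inside J) = J"
    if "arc g" "arc h" "pathstart g = a" "pathstart h = a" "pathfinish g = b" "pathfinish h = b"
      "path_image g \<inter> path_image h = {a, b}" "J = path_image g \<union> path_image h" for g h J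
  proof -
    have "simple_path (g +++ reversepath h)"
      using that by (intro simple_path_join_loop) (auto simp: arc_reversepath)
    moreover have "path_image (g +++ reversepath h) = J"
      using that by (simp add: path_image_join)
    moreover have "pathfinish (g +++ reversepath h) = pathstart (g +++ reversepath h)"
      using that by simp
    ultimately show ?thesis
      using Jordan_inside_outside[of "g +++ reversepath h"] that
      by (auto intro: closed_Un bounded_Un[THEN iffD2] closed_arc_image bounded_arc_image)
  qed
  define J12 J13 J23 where "J12 = path_image c1 \<union> path_image c2"
    and "J13 = path_image c1 \<union> path_image c3" and "J23 = path_image c2 \<union> path_image c3"
  note J12 = jordan[OF arcs(1,2) start(1,2) finish(1,2) int(1) J12_def]
  note J13 = jordan[OF arcs(1,3) start(1,3) finish(1,3) int(2) J13_def]
  note J23 = jordan[OF arcs(2,3) start(2,3) finish(2,3) int(3) J23_def]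
  \<comment> \<open>Without its ends the arc is connected and avoids \<open>J23\<close>, so it lies
    on one side, and \<open>p1\<close> shows that this is not the inside.\<close>
  have c1_out: "path_image c1 \<inter> inside J23 = {}"
  proof -
    have "connected (path_image c1 - {a, b})"
      using connected_simple_path_endless[OF arc_imp_simple_path[OF arcs(1)]] start finish by simp
    moreover have "path_image c1 - {a, b} \<subseteq> - J23"
      using int by (auto simp: J23_def)
    ultimately have "connected_component (- J23) q p1" if "q \<in> path_image c1 - {a, b}" for q
      using that p1(1) unfolding connected_component_def by blast
    then have "q \<notin> inside J23" if "q \<in> path_image c1 - {a, b}" for q
      using that inside_same_component p1(2) unfolding J23_def by blast
    moreover have "a \<in> J23" "b \<in> J23"
      using int(3) by (auto simp: J23_def)
    ultimately show ?thesis
      using inside_no_overlap[of J23] by blast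
  qed
  \<comment> \<open>If \<open>inside J23\<close> met \<open>inside J\<close>, connectedness would
    put it wholly there. Then \<open>q\<close>, a point of its frontier \<open>J23\<close>, would
    lie in \<open>closure (inside J)\<close>, hence on \<open>J\<close> or inside it.\<close>
  have sub_out: "inside J23 \<subseteq> outside J"
    if "connected (inside J23)" "inside J23 \<inter> J = {}" and q: "q \<in> J23" "q \<notin> J" "q \<notin> inside J"
      and "closed J" for J q
  proof -
    have "inside J23 \<inter> inside J = {}"
    proof (rule ccontr)
      assume "inside J23 \<inter> inside J \<noteq> {}"
      then obtain z where z: "z \<in> inside J23" "z \<in> inside J" by blast
      have "w \<in> inside J" if "w \<in> inside J23" for w
      proof (rule inside_same_component[OF _ z(2)])
        show "connected_component (- J) z w"
          unfolding connected_component_def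
          using \<open>connected (inside J23)\<close> \<open>inside J23 \<inter> J = {}\<close> z(1) that
          by (intro exI[of _ "inside J23"]) auto
      qed
      then have "closure (inside J23) \<subseteq> closure (inside J)" by (intro closure_mono) auto
      moreover have "q \<in> closure (inside J23)"
        using J23 q(1) by (auto simp: frontier_def)
      ultimately show False
        using closure_inside_subset[OF \<open>closed J\<close>] q by blast
    qed
    then show ?thesis
      using \<open>inside J23 \<inter> J = {}\<close> inside_Un_outside[of J] by blast
  qed
  have no: "inside J23 \<inter> path_image c2 = {}" "inside J23 \<inter> path_image c3 = {}"
    using inside_no_overlap[of J23] unfolding J23_def by blast+
  have o12: "inside J23 \<subseteq> outside J12"
    using c1_out no J23 J12 p3 p3_out int
    by (intro sub_out[of _ p3]) (auto simp: J12_def J23_def)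
  have o13: "inside J23 \<subseteq> outside J13"
    using c1_out no J23 J13 p2 int
    by (intro sub_out[of _ p2]) (auto simp: J13_def J23_def)
  obtain z where z: "z \<in> inside J23" using J23 by blast
  have "bounded (J12 \<union> J13)" using J12 J13 by simp
  then obtain w where w: "w \<in> outside (J12 \<union> J13)"
    using outside_bounded_nonempty by blast
  have w': "w \<in> outside J12" "w \<in> outside J13" "w \<in> outside J23"
    using w outside_mono[of J12 "J12 \<union> J13"] outside_mono[of J13 "J12 \<union> J13"]
      outside_mono[of J23 "J12 \<union> J13"] by (auto simp: J12_def J13_def J23_def)
  have "connected_component (- (J12 \<union> J13)) z w"
  proof (rule Janiszewski)
    show "compact J12" "closed J13" using J12 J13 by (auto simp: compact_eq_bounded_closed)
    have "J12 \<inter> J13 = path_image c1"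
      using int by (auto simp: J12_def J13_def)
    then show "connected (J12 \<inter> J13)" using arcs(1) by (simp add: connected_arc_image)
    show "connected_component (- J12) z w"
      unfolding connected_component_def using J12 z w' o12 outside_no_overlap[of J12]
      by (intro exI[of _ "outside J12"]) blast
    show "connected_component (- J13) z w"
      unfolding connected_component_def using J13 z w' o13 outside_no_overlap[of J13]
      by (intro exI[of _ "outside J13"]) blast
  qed
  then have "connected_component (- J23) z w"
    by (rule connected_component_of_subset) (auto simp: J12_def J13_def J23_def)
  then have "w \<in> inside J23" using inside_same_component z by blast
  then show False using w' inside_Int_outside[of J23] by blast
qed

section \<open>Paths of a drawn graph as arcs in the plane\<close>

fun path_edges :: "'a list \<Rightarrow> 'a set set" where
  "path_edges (x # y # zs) = insert {x, y} (path_edges (y # zs))"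
| "path_edges _ = {}"

lemma path_edges_walk: "walk E vs \<Longrightarrow> path_edges vs \<subseteq> E"
  by (induction vs rule: path_edges.induct) auto

lemma path_edges_subset: "e \<in> path_edges vs \<Longrightarrow> e \<subseteq> set vs"
  by (induction vs rule: path_edges.induct) auto

lemma path_edges_cover: "2 \<le> length vs \<Longrightarrow> v \<in> set vs \<Longrightarrow> \<exists>e\<in>path_edges vs. v \<in> e"
proof (induction vs rule: path_edges.induct)
  case (1 x y zs)
  then show ?case by (cases zs) auto
qed auto

text \<open>This is why internally disjoint paths share no edge: only \<open>{p, q}\<close> could
  miss \<open>l\<close>, and a nonempty \<open>l\<close> separates \<open>p\<close> from
  \<open>q\<close> in the list.\<close>

lemma path_edges_interior:
  assumes "e \<in> path_edges (p # l @ [q])" "l \<noteq> []" "distinct (p # q # l)"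
  shows "e \<inter> set l \<noteq> {}"
proof (rule ccontr)
  assume no: "\<not> ?thesis"
  have *: "e \<in> path_edges (r # l @ [q]) \<Longrightarrow> e = {r, hd (l @ [q])} \<or> e \<inter> set l \<noteq> {}" for r
    by (induction l arbitrary: r) auto
  show False
    using *[OF assms(1)] assms(2) no by (cases l) auto
qed

lemma planar_embedding_Int:
  assumes "planar_embedding (V, E) pos \<gamma>" "e \<in> E" "e' \<in> E" "e \<noteq> e'"
  shows "path_image (\<gamma> e) \<inter> path_image (\<gamma> e') = pos ` (e \<inter> e')"
  using assms by (simp add: planar_embedding_def)

text \<open>The arcs of the edges are joined one after another. An edge has no direction, so its arc
  may have to be reversed; planarity makes the rest of the path meet it only at the shared vertex
  \<open>y\<close>.\<close>

lemma path_arc: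
  assumes P: "planar_embedding (V, E) pos \<gamma>"
    and "distinct vs" "2 \<le> length vs" "walk E vs"
  shows "\<exists>g. arc g \<and> pathstart g = pos (hd vs) \<and> pathfinish g = pos (last vs) \<and>
    path_image g = (\<Union>e\<in>path_edges vs. path_image (\<gamma> e))"
  using assms(2-)
proof (induction vs rule: path_edges.induct)
  case (1 x y zs)
  have "{x, y} \<in> E" using 1 by simp
  then have g: "arc (\<gamma> {x, y})" "{pathstart (\<gamma> {x, y}), pathfinish (\<gamma> {x, y})} = {pos x, pos y}"
    using P by (auto simp: planar_embedding_def)
  have "\<exists>g. arc g \<and> pathstart g = pos x \<and> pathfinish g = pos y \<and> path_image g = path_image (\<gamma> {x, y})"
  proof (cases "pathstart (\<gamma> {x, y}) = pos x")
    case True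
    then show ?thesis using g by (intro exI[of _ "\<gamma> {x, y}"]) (auto simp: doubleton_eq_iff)
  next
    case False
    then show ?thesis
      using g by (intro exI[of _ "reversepath (\<gamma> {x, y})"]) (auto simp: doubleton_eq_iff arc_reversepath)
  qed
  then obtain g where g: "arc g" "pathstart g = pos x" "pathfinish g = pos y"
    "path_image g = path_image (\<gamma> {x, y})" by blast
  show ?case
  proof (cases zs)
    case Nil
    then show ?thesis using g by (intro exI[of _ g]) auto
  next
    case (Cons z zs')
    then obtain h where h: "arc h" "pathstart h = pos y" "pathfinish h = pos (last (y # zs))"
      "path_image h = (\<Union>e\<in>path_edges (y # zs). path_image (\<gamma> e))"
      using 1 by auto
    have "path_image g \<inter> path_image h \<subseteq> {pos y}"
    proof -
      have "path_image (\<gamma> {x, y}) \<inter> path_image (\<gamma> e) \<subseteq> {pos y}" if e: "e \<in> path_edges (y # zs)" for e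
      proof -
        have "x \<notin> e" using path_edges_subset[OF e] 1 by auto
        moreover have "e \<in> E" using path_edges_walk[of E "y # zs"] 1 e by auto
        ultimately have "path_image (\<gamma> {x, y}) \<inter> path_image (\<gamma> e) = pos ` ({x, y} \<inter> e)"
          using planar_embedding_Int[OF P \<open>{x, y} \<in> E\<close>] by blast
        then show ?thesis using \<open>x \<notin> e\<close> by auto
      qed
      then show ?thesis using g(4) h(4) by auto
    qed
    then have "arc (g +++ h)" using g h by (intro arc_join) auto
    moreover have "path_image (g +++ h) = (\<Union>e\<in>path_edges (x # y # zs). path_image (\<gamma> e))"
      using g h by (simp add: path_image_join)
    ultimately show ?thesis
      using g h by (intro exI[of _ "g +++ h"]) auto
  qed
qed auto

lemma path_arc_between:
  assumes P: "planar_embedding (V, E) pos \<gamma>"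
    and "distinct (p # q # l)" "walk E (p # l @ [q])"
  obtains g where "arc g" "pathstart g = pos p" "pathfinish g = pos q"
    "path_image g = (\<Union>e\<in>path_edges (p # l @ [q]). path_image (\<gamma> e))"
  using path_arc[OF P, of "p # l @ [q]"] assms that by auto

lemma path_image_mem:
  assumes P: "planar_embedding (V, E) pos \<gamma>" and w: "walk E (p # l @ [q])"
    and v: "v \<in> set (p # l @ [q])"
  shows "pos v \<in> (\<Union>e\<in>path_edges (p # l @ [q]). path_image (\<gamma> e))"
proof -
  obtain e where e: "e \<in> path_edges (p # l @ [q])" "v \<in> e"
    using path_edges_cover[of "p # l @ [q]" v] v by auto
  then have "e \<in> E" using path_edges_walk[OF w] by blast
  then have "pos v \<in> path_image (\<gamma> e)"
    using P e(2) unfolding planar_embedding_def snd_conv by blast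
  then show ?thesis using e by blast
qed

text \<open>Every edge of the first path contains a vertex of \<open>l\<close>, so it is no edge of
  the second, and planarity reduces the intersection to common endpoints. As \<open>l'\<close> may
  be empty, this covers a path and a chord.\<close>

lemma path_images_Int:
  assumes P: "planar_embedding (V, E) pos \<gamma>"
    and w: "walk E (p # l @ [q])" "walk E (p # l' @ [q])"
    and d: "distinct (p # q # l @ l')" and l: "l \<noteq> []"
  shows "(\<Union>e\<in>path_edges (p # l @ [q]). path_image (\<gamma> e)) \<inter>
    (\<Union>e\<in>path_edges (p # l' @ [q]). path_image (\<gamma> e)) = {pos p, pos q}" (is "?A \<inter> ?B = _")
proof
  show "{pos p, pos q} \<subseteq> ?A \<inter> ?B"
    using path_image_mem[OF P w(1), of p] path_image_mem[OF P w(1), of q]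
      path_image_mem[OF P w(2), of p] path_image_mem[OF P w(2), of q] by simp
  show "?A \<inter> ?B \<subseteq> {pos p, pos q}"
  proof
    fix z assume "z \<in> ?A \<inter> ?B"
    then obtain e e' where e: "e \<in> path_edges (p # l @ [q])" "z \<in> path_image (\<gamma> e)"
      and e': "e' \<in> path_edges (p # l' @ [q])" "z \<in> path_image (\<gamma> e')" by blast
    have "e \<inter> set l \<noteq> {}" using path_edges_interior[OF e(1) l] d by simp
    moreover have sub: "e \<subseteq> set (p # l @ [q])" "e' \<subseteq> set (p # l' @ [q])"
      using path_edges_subset e(1) e'(1) by blast+
    ultimately have "e \<noteq> e'" using d by auto
    moreover have "e \<in> E" "e' \<in> E" using path_edges_walk w e(1) e'(1) by blast+
    ultimately have "path_image (\<gamma> e) \<inter> path_image (\<gamma> e') = pos ` (e \<inter> e')"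
      using planar_embedding_Int[OF P] \<open>e \<noteq> e'\<close> by blast
    moreover have "e \<inter> e' \<subseteq> {p, q}" using sub d by auto
    ultimately show "z \<in> {pos p, pos q}" using e(2) e'(2) by blast
  qed
qed

section \<open>Outerplanar drawings contain neither theta graphs nor K_4\<close>

locale outerplanar_drawing =
  fixes V :: "'a set" and E :: "'a set set" and pos :: "'a \<Rightarrow> complex"
    and \<gamma> :: "'a set \<Rightarrow> real \<Rightarrow> complex"
  assumes simple: "simple_graph (V, E)"
    and planar: "planar_embedding (V, E) pos \<gamma>"
    and outer: "pos ` V \<subseteq> frontier (outside (drawing (V, E) pos \<gamma>))"
begin

definition path_trace :: "'a list \<Rightarrow> complex set" where
  "path_trace vs = (\<Union>e\<in>path_edges vs. path_image (\<gamma> e))"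

lemma walk_verts: "walk E vs \<Longrightarrow> 2 \<le> length vs \<Longrightarrow> set vs \<subseteq> V"
  using path_edges_cover path_edges_walk simple unfolding simple_graph_def by fastforce

lemma path_verts: "walk E (p # l @ [q]) \<Longrightarrow> v \<in> set (p # l @ [q]) \<Longrightarrow> v \<in> V"
  using walk_verts[of "p # l @ [q]"] by auto

lemma path_trace_mem: "walk E (p # l @ [q]) \<Longrightarrow> v \<in> set (p # l @ [q]) \<Longrightarrow> pos v \<in> path_trace (p # l @ [q])"
  unfolding path_trace_def by (rule path_image_mem[OF planar])

lemma pos_inj: "u \<in> V \<Longrightarrow> v \<in> V \<Longrightarrow> pos u = pos v \<longleftrightarrow> u = v"
  using planar by (auto simp: planar_embedding_def inj_on_def)

lemma path_trace_not_mem: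
  assumes w: "walk E vs" and v: "v \<in> V" "v \<notin> set vs"
  shows "pos v \<notin> path_trace vs"
proof
  assume "pos v \<in> path_trace vs"
  then obtain e where e: "e \<in> path_edges vs" "pos v \<in> path_image (\<gamma> e)"
    by (auto simp: path_trace_def)
  have "e \<in> E" using e(1) path_edges_walk[OF w] by blast
  then have "path_image (\<gamma> e) \<inter> pos ` V = pos ` e" "e \<subseteq> V"
    using planar simple by (auto simp: planar_embedding_def simple_graph_def)
  then have "v \<in> e" using e(2) v(1) pos_inj by blast
  then show False using path_edges_subset[OF e(1)] v(2) by blast
qed

lemma not_inside_path_trace:
  assumes "walk E xs" "walk E ys" "v \<in> V"
  shows "pos v \<notin> inside (path_trace xs \<union> path_trace ys)"
proof (rule frontier_outside_not_inside)
  have E: "path_edges xs \<subseteq> E" "path_edges ys \<subseteq> E"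
    using path_edges_walk assms by blast+
  have "finite (path_edges xs)" "finite (path_edges ys)"
    using E finite_edges[OF simple] finite_subset by blast+
  moreover have "closed (path_image (\<gamma> e))" if "e \<in> E" for e
    using planar that by (auto simp: planar_embedding_def closed_arc_image)
  ultimately show "closed (path_trace xs \<union> path_trace ys)"
    using E unfolding path_trace_def by (intro closed_Un closed_UN) auto
  show "path_trace xs \<union> path_trace ys \<subseteq> drawing (V, E) pos \<gamma>"
    using E by (auto simp: path_trace_def drawing_def)
  show "pos v \<in> frontier (outside (drawing (V, E) pos \<gamma>))"
    using outer assms(3) by blast
qed

lemma path_arc_trace:
  assumes "distinct (p # q # l)" "walk E (p # l @ [q])"
  obtains g where "arc g" "pathstart g = pos p" "pathfinish g = pos q"
    "path_image g = path_trace (p # l @ [q])"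
  using path_arc_between[OF planar assms] unfolding path_trace_def by blast

lemma path_trace_Int:
  assumes "walk E (p # l @ [q])" "walk E (p # l' @ [q])" "distinct (p # q # l @ l')" "l \<noteq> []"
  shows "path_trace (p # l @ [q]) \<inter> path_trace (p # l' @ [q]) = {pos p, pos q}"
  using path_images_Int[OF planar assms] unfolding path_trace_def .

text \<open>The vertices \<open>hd l1\<close> and \<open>hd l2\<close> are the points off the
  insides that \<open>theta_curve_inside\<close> asks for. The list \<open>l3\<close> may be empty:
  a chord also runs inside its cycle.\<close>

lemma third_path_inside:
  assumes d: "distinct (p # q # l1 @ l2 @ l3)" and ne: "l1 \<noteq> []" "l2 \<noteq> []"
    and w: "walk E (p # l1 @ [q])" "walk E (p # l2 @ [q])" "walk E (p # l3 @ [q])"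
  shows "path_trace (p # l3 @ [q]) - {pos p, pos q} \<subseteq>
    inside (path_trace (p # l1 @ [q]) \<union> path_trace (p # l2 @ [q]))"
proof
  fix z assume z: "z \<in> path_trace (p # l3 @ [q]) - {pos p, pos q}"
  obtain g1 where g1: "arc g1" "pathstart g1 = pos p" "pathfinish g1 = pos q"
    "path_image g1 = path_trace (p # l1 @ [q])"
    using path_arc_trace[of p q l1] w d by auto
  obtain g2 where g2: "arc g2" "pathstart g2 = pos p" "pathfinish g2 = pos q"
    "path_image g2 = path_trace (p # l2 @ [q])"
    using path_arc_trace[of p q l2] w d by auto
  obtain g3 where g3: "arc g3" "pathstart g3 = pos p" "pathfinish g3 = pos q"
    "path_image g3 = path_trace (p # l3 @ [q])"
    using path_arc_trace[of p q l3] w d by auto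

  have mem: "pos (hd l) \<in> path_trace (p # l @ [q]) - {pos p, pos q}" "hd l \<in> V"
    if "walk E (p # l @ [q])" "l \<noteq> []" "p \<notin> set l" "q \<notin> set l" for l
  proof -
    have h: "hd l \<in> set l" using that by simp
    then show "hd l \<in> V" using path_verts[OF that(1), of "hd l"] by simp
    then show "pos (hd l) \<in> path_trace (p # l @ [q]) - {pos p, pos q}"
      using h that path_trace_mem[OF that(1), of "hd l"] pos_inj[of "hd l" p] pos_inj[of "hd l" q]
        path_verts[OF that(1), of p] path_verts[OF that(1), of q] by auto
  qed
  show "z \<in> inside (path_trace (p # l1 @ [q]) \<union> path_trace (p # l2 @ [q]))"
    unfolding g1(4)[symmetric] g2(4)[symmetric]
  proof (rule theta_curve_inside[OF g1(1) g2(1) g3(1) g1(2) g2(2) g3(2) g1(3) g2(3) g3(3)])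
    show "path_image g1 \<inter> path_image g2 = {pos p, pos q}"
      "path_image g1 \<inter> path_image g3 = {pos p, pos q}"
      "path_image g2 \<inter> path_image g3 = {pos p, pos q}"
      unfolding g1(4) g2(4) g3(4)
      using path_trace_Int[OF w(1,2)] path_trace_Int[OF w(1,3)] path_trace_Int[OF w(2,3)] d ne
      by (simp_all add: Int_Un_distrib)
    show "pos (hd l1) \<in> path_image g1 - {pos p, pos q}" "pos (hd l2) \<in> path_image g2 - {pos p, pos q}"
      unfolding g1(4) g2(4) using mem w ne d by simp_all
    show "pos (hd l1) \<notin> inside (path_image g2 \<union> path_image g3)"
      "pos (hd l2) \<notin> inside (path_image g1 \<union> path_image g3)"
      unfolding g1(4) g2(4) g3(4)
      using not_inside_path_trace[OF w(2,3)] not_inside_path_trace[OF w(1,3)] mem(2) w ne d by simp_all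
    show "z \<in> path_image g3 - {pos p, pos q}" using z g3(4) by simp
  qed
qed

text \<open>Otherwise \<open>hd l3\<close> would be a vertex inside the cycle formed by the other
  two paths.\<close>

lemma theta_free: "theta_free E"
  unfolding theta_free_def
proof (intro allI impI notI)
  fix p q l1 l2 l3
  assume d: "distinct (p # q # l1 @ l2 @ l3) \<and> l1 \<noteq> [] \<and> l2 \<noteq> [] \<and> l3 \<noteq> []"
    and w: "walk E (p # l1 @ [q]) \<and> walk E (p # l2 @ [q]) \<and> walk E (p # l3 @ [q])"
  have s: "hd l3 \<in> set l3" using d by simp
  have V: "p \<in> V" "q \<in> V" "hd l3 \<in> V" using path_verts[of p l3 q] w s by auto
  have "pos (hd l3) \<in> path_trace (p # l3 @ [q]) - {pos p, pos q}"
    using s V d w path_trace_mem[of p l3 q "hd l3"] pos_inj[of "hd l3" p] pos_inj[of "hd l3" q] by auto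
  then have "pos (hd l3) \<in> inside (path_trace (p # l1 @ [q]) \<union> path_trace (p # l2 @ [q]))"
    using third_path_inside[of p q l1 l2 l3] d w by blast
  then show False using not_inside_path_trace[of "p # l1 @ [q]" "p # l2 @ [q]" "hd l3"] w s V by auto
qed

text \<open>Both diagonals of the four-cycle \<open>a\<close>, \<open>b\<close>, \<open>c\<close>,
  \<open>d\<close> run inside it. The one from \<open>a\<close> to \<open>c\<close> cuts the inside
  into two regions; the one from \<open>b\<close> to \<open>d\<close> is disjoint from it and enters
  one of them. Following it to the proper end puts \<open>b\<close> or \<open>d\<close> inside a
  triangle.\<close>

lemma K4_free: "K4_free E"
proof (rule K4_freeI)
  fix a b c d assume dist: "distinct [a, b, c, d]"
    and e: "{a, b} \<in> E" "{a, c} \<in> E" "{a, d} \<in> E" "{b, c} \<in> E" "{b, d} \<in> E" "{c, d} \<in> E"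
  have V: "a \<in> V" "b \<in> V" "c \<in> V" "d \<in> V"
    using simple e by (auto simp: simple_graph_def)
  have e': "{b, a} \<in> E" "{c, b} \<in> E" "{d, c} \<in> E" "{d, a} \<in> E" "{c, a} \<in> E" "{d, b} \<in> E"
    using e by (simp_all add: insert_commute)
  let ?c1 = "path_trace [a, b, c]" and ?c2 = "path_trace [a, d, c]" and ?c = "path_trace [a, c]"
  have w: "walk E [a, b, c]" "walk E [a, d, c]" "walk E [a, c]" "walk E [b, d]"
    using e e' by auto
  obtain g1 where g1: "arc g1" "pathstart g1 = pos a" "pathfinish g1 = pos c" "path_image g1 = ?c1"
    using path_arc_trace[of a c "[b]"] w dist by auto
  obtain g2 where g2: "arc g2" "pathstart g2 = pos a" "pathfinish g2 = pos c" "path_image g2 = ?c2"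
    using path_arc_trace[of a c "[d]"] w dist by auto
  obtain g where g: "arc g" "pathstart g = pos a" "pathfinish g = pos c" "path_image g = ?c"
    using path_arc_trace[of a c "[]"] w dist by auto
  obtain h where h: "arc h" "pathstart h = pos b" "pathfinish h = pos d" "path_image h = path_trace [b, d]"
    using path_arc_trace[of b d "[]"] w dist by auto
  \<comment> \<open>The same four-cycle, split at \<open>b\<close> and \<open>d\<close> in place of
    \<open>a\<close> and \<open>c\<close>.\<close>
  have J: "path_trace [b, a, d] \<union> path_trace [b, c, d] = ?c1 \<union> ?c2"
    by (auto simp: path_trace_def insert_commute)
  have c_in: "?c - {pos a, pos c} \<subseteq> inside (?c1 \<union> ?c2)"
    using third_path_inside[of a c "[b]" "[d]" "[]"] w dist by auto
  have h_in: "path_image h - {pos b, pos d} \<subseteq> inside (?c1 \<union> ?c2)"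
    using third_path_inside[of b d "[a]" "[c]" "[]"] e e' dist J h(4) by auto
  have int: "path_image g1 \<inter> path_image g2 = {pos a, pos c}" "path_image g1 \<inter> path_image g = {pos a, pos c}"
    "path_image g2 \<inter> path_image g = {pos a, pos c}"
    unfolding g1(4) g2(4) g(4)
    using path_trace_Int[of a "[b]" c "[d]"] path_trace_Int[of a "[b]" c "[]"]
      path_trace_Int[of a "[d]" c "[]"] w dist by auto
  have "pos a \<noteq> pos c" using pos_inj V dist by auto
  have "{a, c} \<noteq> {b, d}" "{a, c} \<inter> {b, d} = {}" using dist by auto
  then have h_c: "path_image h \<inter> ?c = {}"
    unfolding h(4) using planar_embedding_Int[OF planar e(5,2)] by (auto simp: path_trace_def)
  have "path_image g - {pos a, pos c} \<noteq> {}"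
    using connected_arc_image[OF g(1)] g(2,3) \<open>pos a \<noteq> pos c\<close>
      pathstart_in_path_image[of g] pathfinish_in_path_image[of g]
    by (metis Diff_eq_empty_iff finite.emptyI finite_insert finite_subset connected_finite_iff_sing
        insert_absorb insert_not_empty singletonD)
  then have ne: "path_image g \<inter> inside (path_image g1 \<union> path_image g2) \<noteq> {}"
    using c_in g(4) g1(4) g2(4) by auto
  obtain "inside (?c1 \<union> ?c) \<union> inside (?c2 \<union> ?c) \<union> (?c - {pos a, pos c}) = inside (?c1 \<union> ?c2)"
    using split_inside_simple_closed_curve[OF arc_imp_simple_path[OF g1(1)] g1(2,3)
        arc_imp_simple_path[OF g2(1)] g2(2,3) arc_imp_simple_path[OF g(1)] g(2,3)
        \<open>pos a \<noteq> pos c\<close> int ne] unfolding g1(4) g2(4) g(4) by metis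
  then have cover: "path_image h - {pos b, pos d} \<subseteq> inside (?c1 \<union> ?c) \<union> inside (?c2 \<union> ?c)"
    using h_in h_c by blast
  have h01: "h 0 = pos b" "h 1 = pos d" "inj_on h {0..1}" "continuous_on {0..1} h"
    using h by (auto simp: pathstart_def pathfinish_def arc_def path_def)
  have half: "h (1/2) \<in> path_image h - {pos b, pos d}"
    using inj_on_eq_iff[OF h01(3), of "1/2" 0] inj_on_eq_iff[OF h01(3), of "1/2" 1]
    unfolding h01(1)[symmetric] h01(2)[symmetric] path_image_def by auto
  have b_out: "pos b \<notin> ?c2 \<union> ?c" "pos d \<notin> ?c1 \<union> ?c"
    using path_trace_not_mem w V dist by auto
  have h_J: "path_image h \<inter> (?c1 \<union> ?c2) \<subseteq> {pos b, pos d}"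
    using h_in inside_no_overlap[of "?c1 \<union> ?c2"] by blast
  have spread: "z \<in> inside T" if "S \<subseteq> {0..1}" "connected S" "h ` S \<inter> T = {}" "1/2 \<in> S"
    "h (1/2) \<in> inside T" "z \<in> h ` S" for S T z
  proof (rule inside_same_component[OF _ that(5)])
    have "connected (h ` S)"
      using that h01(4) by (intro connected_continuous_image) (auto intro: continuous_on_subset)
    then show "connected_component (- T) (h (1/2)) z"
      unfolding connected_component_def using that by (intro exI[of _ "h ` S"]) auto
  qed
  have h_J': "path_image h \<inter> (?c2 \<union> ?c1) \<subseteq> {pos d, pos b}"
    using h_J by (simp add: Un_commute insert_commute)
  have avoid: "S \<inter> (A \<union> B) = {}"
    if "S \<subseteq> P - {u}" "P \<inter> (A \<union> C) \<subseteq> {u, v}" "P \<inter> B = {}" "v \<notin> A \<union> B"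
    for S P A B C :: "complex set" and u v
    using that by blast
  from half cover consider "h (1/2) \<in> inside (?c1 \<union> ?c)" | "h (1/2) \<in> inside (?c2 \<union> ?c)" by blast
  then show False
  proof cases
    case 1
    \<comment> \<open>Away from \<open>b\<close> the second diagonal never meets the triangle
      \<open>a\<close>, \<open>b\<close>, \<open>c\<close>: it touches the four-cycle only at its
      ends, and \<open>d\<close> is not on the triangle.\<close>
    have "h ` {0<..1} \<subseteq> path_image h - {pos b}"
      using inj_on_eq_iff[OF h01(3), of _ 0] unfolding h01(1)[symmetric] path_image_def by auto
    then have disj: "h ` {0<..1} \<inter> (?c1 \<union> ?c) = {}" by (rule avoid[OF _ h_J h_c b_out(2)])
    have mem: "pos d \<in> h ` {0<..1}"
      using h01(2) by (intro image_eqI[of _ _ 1]) auto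
    have "pos d \<in> inside (?c1 \<union> ?c)"
      by (rule spread[OF _ _ disj _ 1 mem]) auto
    then show False using not_inside_path_trace[OF w(1,3) V(4)] by blast
  next
    case 2
    have "h ` {0..<1} \<subseteq> path_image h - {pos d}"
      using inj_on_eq_iff[OF h01(3), of _ 1] unfolding h01(2)[symmetric] path_image_def by auto
    then have disj: "h ` {0..<1} \<inter> (?c2 \<union> ?c) = {}"
      by (rule avoid[OF _ h_J' h_c b_out(1)])
    have mem: "pos b \<in> h ` {0..<1}"
      using h01(1) by (intro image_eqI[of _ _ 0]) auto
    have "pos b \<in> inside (?c2 \<union> ?c)"
      by (rule spread[OF _ _ disj _ 2 mem]) auto
    then show False using not_inside_path_trace[OF w(2,3) V(2)] by blast
  qed
qed

end

subsection \<open>Double stars and windmills\<close>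

lemma double_star_22: "double_star 2 2 = ({..<6}, {{0, 1}, {0, 2}, {0, 3}, {1, 4}, {1, 5}})"
proof -
  have "{2..<2 + 2} = {2, 3::nat}" "{2 + 2..<2 + 2 + 2} = {4, 5::nat}" by auto
  then show ?thesis by (auto simp: double_star_def)
qed

lemma S22_free_of_H_free:
  assumes "simple_graph (V, E)" "H_free (double_star 2 2) (V, E)"
  shows "S22_free E"
  unfolding S22_free_def
proof (intro allI impI notI)
  fix x y a b c d
  assume dist: "distinct [x, y, a, b, c, d]"
    and e: "{{x, y}, {x, a}, {x, b}, {y, c}, {y, d}} \<subseteq> E"
  let ?G = "({x, y, a, b, c, d}, {{x, y}, {x, a}, {x, b}, {y, c}, {y, d}})"
  have "subgraph ?G (V, E)"
    using assms(1) e dist by (auto simp: subgraph_def simple_graph_def card_insert_if)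
  moreover have "graph_isomorphic ?G (double_star 2 2)"
  proof -
    define f where "f v = (if v = x then 0 else if v = y then 1 else if v = a then 2
      else if v = b then 3 else if v = c then 4 else 5 :: nat)" for v
    have f: "f x = 0" "f y = 1" "f a = 2" "f b = 3" "f c = 4" "f d = 5"
      using dist by (auto simp: f_def)
    have "{..<6} = {0, 1, 2, 3, 4, 5::nat}" by auto
    then have "bij_betw f {x, y, a, b, c, d} {..<6}"
      using dist f by (auto simp: bij_betw_def inj_on_def)
    then show ?thesis
      using f unfolding graph_isomorphic_def double_star_22 by (intro exI[of _ f]) simp
  qed
  ultimately show False using assms(2) unfolding H_free_def by blast
qed

lemma H_free_of_S22_free:
  assumes "S22_free E"
  shows "H_free (double_star 2 2) (V, E)"
  unfolding H_free_def
proof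
  assume "\<exists>G'. subgraph G' (V, E) \<and> graph_isomorphic G' (double_star 2 2)"
  then obtain V' E' f where G': "simple_graph (V', E')" "E' \<subseteq> E"
    and f: "bij_betw f V' {..<6::nat}" "{{0, 1}, {0, 2}, {0, 3}, {1, 4}, {1, 5}} = (\<lambda>e. f ` e) ` E'"
    unfolding double_star_22 graph_isomorphic_def subgraph_def by fastforce
  define g where "g = inv_into V' f"
  have g: "inj_on g {..<6}"
    using f(1) bij_betw_imp_inj_on[OF bij_betw_inv_into[OF f(1)]] by (simp add: g_def)
  have edge: "{g i, g j} \<in> E" if ij: "{i, j} \<in> {{0, 1}, {0, 2}, {0, 3}, {1, 4}, {1, 5}}" for i j :: nat
  proof -
    obtain e where e: "e \<in> E'" "{i, j} = f ` e" using ij unfolding f(2) by blast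
    have "e \<subseteq> V'" using G'(1) e(1) by (simp add: simple_graph_def)
    then have "g ` f ` e = e"
      using f(1) unfolding g_def by (intro inv_into_image_cancel) (auto simp: bij_betw_def)
    then have "e = {g i, g j}" unfolding e(2)[symmetric] by simp
    then show ?thesis using e(1) G'(2) by auto
  qed
  have "distinct [g 0, g 1, g 2, g 3, g 4, g 5]"
    using g by (simp add: inj_on_eq_iff)
  then show False
    using assms edge[of 0 1] edge[of 0 2] edge[of 0 3] edge[of 1 4] edge[of 1 5]
      S22_freeD[of E "g 0" "g 1" "g 2" "g 3" "g 4" "g 5"] by simp
qed

lemma admissible_edge_bound:
  assumes "G \<in> admissible_graphs n (double_star 2 2)" "6 \<le> n"
  shows "2 * card (edges G) + 3 \<le> 3 * n"
proof -
  obtain V E where G: "G = (V, E)" by (cases G)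
  have *: "simple_graph (V, E)" "card V = n" "connected_graph (V, E)"
    "H_free (double_star 2 2) (V, E)" "outerplanar (V, E)"
    using assms(1) by (auto simp: admissible_graphs_def G)
  then obtain pos \<gamma> where "planar_embedding (V, E) pos \<gamma>"
    "pos ` V \<subseteq> frontier (outside (drawing (V, E) pos \<gamma>))"
    by (auto simp: outerplanar_def)
  then interpret outerplanar_drawing V E pos \<gamma>
    using * by unfold_locales
  show ?thesis
    using S22_free_edge_bound[of V E] S22_free_of_H_free[OF *(1,4)] * theta_free K4_free assms(2) G
    by simp
qed

section \<open>Windmills and their straight-line drawing\<close>

text \<open>The hub is 0, and the rim edges pair 1 with 2, 3 with 4 and so on. For positive even
  \<open>n\<close> the vertex \<open>n - 1\<close> has no partner and is the pendant one.\<close>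

definition windmill_edges :: "nat \<Rightarrow> nat set set" where
  "windmill_edges n = (\<lambda>i. {0, i}) ` {1..<n} \<union> (\<lambda>j. {2 * j + 1, 2 * j + 2}) ` {..<(n - 1) div 2}"

lemma windmill_edges_cases:
  assumes "e \<in> windmill_edges n"
  obtains i where "e = {0, i}" "0 < i" "i < n"
  | j where "e = {2 * j + 1, 2 * j + 2}" "2 * j + 2 < n"
  using assms by (auto simp: windmill_edges_def)

lemma simple_graph_windmill: "simple_graph ({..<n}, windmill_edges n)"
  by (auto simp: simple_graph_def elim!: windmill_edges_cases)

lemma connected_graph_windmill:
  assumes "0 < n"
  shows "connected_graph ({..<n}, windmill_edges n)"
proof -
  let ?r = "{(a, b). {a, b} \<in> windmill_edges n}"
  have edge: "(0, i) \<in> ?r" "(i, 0) \<in> ?r" if "0 < i" "i < n" for i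
    using that by (auto simp: windmill_edges_def insert_commute)
  have "(u, 0) \<in> ?r\<^sup>*" "(0, u) \<in> ?r\<^sup>*" if "u < n" for u
    using edge[OF _ that] by (cases "u = 0"; blast)+
  then have "(u, v) \<in> ?r\<^sup>*" if "u < n" "v < n" for u v
    using that rtrancl_trans[of u 0 ?r v] by blast
  then show ?thesis
    using assms unfolding connected_graph_def by auto
qed

lemma card_windmill_edges: "card (windmill_edges n) = 3 * (n - 1) div 2"
proof -
  have "card ((\<lambda>i. {0, i}) ` {1..<n}) = n - 1"
    by (subst card_image) (auto simp: inj_on_def doubleton_eq_iff)
  moreover have "card ((\<lambda>j. {2 * j + 1, 2 * j + 2}) ` {..<(n - 1) div 2}) = (n - 1) div 2"
    by (subst card_image) (auto simp: inj_on_def doubleton_eq_iff)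
  moreover have "(\<lambda>i. {0, i}) ` {1..<n} \<inter> (\<lambda>j. {2 * j + 1, 2 * j + 2}) ` {..<(n - 1) div 2} = {}"
  proof -
    have "{0, i} \<noteq> {2 * j + 1, 2 * j + 2}" for i j :: nat
      by (simp add: doubleton_eq_iff)
    then show ?thesis by blast
  qed
  ultimately have "card (windmill_edges n) = n - 1 + (n - 1) div 2"
    unfolding windmill_edges_def by (subst card_Un_disjoint) auto
  then show ?thesis by simp
qed

text \<open>Both centres of a double star have three neighbours, while every vertex other than the
  hub has at most two.\<close>

lemma S22_free_windmill: "S22_free (windmill_edges n)"
proof -
  \<comment> \<open>The second candidate is the rim partner of \<open>v\<close>. It may be missing
    from the graph, as this is only an upper bound on the neighbourhood.\<close>
  have deg: "u \<in> {0, if odd v then v + 1 else v - 1}" if "{v, u} \<in> windmill_edges n" "v \<noteq> 0" for u v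
    using that(1)
  proof (cases rule: windmill_edges_cases)
    case (1 i)
    then show ?thesis using that(2) by (auto simp: doubleton_eq_iff)
  next
    case (2 j)
    then show ?thesis by (auto simp: doubleton_eq_iff)
  qed
  have "v = 0" if "{v, p} \<in> windmill_edges n" "{v, q} \<in> windmill_edges n" "{v, r} \<in> windmill_edges n"
    "distinct [p, q, r]" for v p q r
    using deg[of v p] deg[of v q] deg[of v r] that by (cases "v = 0") auto
  note centre = this
  show ?thesis
    unfolding S22_free_def
  proof (intro allI impI notI)
    fix x y a b c d
    assume "distinct [x, y, a, b, c, d]"
      and "{{x, y}, {x, a}, {x, b}, {y, c}, {y, d}} \<subseteq> windmill_edges n"
    then have "x = 0" "y = 0"
      using centre[of x y a b] centre[of y x c d] by (auto simp: insert_commute)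
    then show False using \<open>distinct [x, y, a, b, c, d]\<close> by simp
  qed
qed

text \<open>With the hub at the origin and all other vertices on the line Re z = 1, the drawing
  stays in a strip that has every vertex on its border.\<close>

definition windmill_pos :: "nat \<Rightarrow> complex" where
  "windmill_pos i = (if i = 0 then 0 else Complex 1 (real i))"

text \<open>\<open>Min\<close> and \<open>Max\<close> give the unordered edge a direction; a spoke
  starts at the hub.\<close>

definition windmill_arc :: "nat set \<Rightarrow> real \<Rightarrow> complex" where
  "windmill_arc e = linepath (windmill_pos (Min e)) (windmill_pos (Max e))"

lemma closed_segment_0_Complex:
  "closed_segment 0 (Complex 1 r) = {z. Im z = Re z * r \<and> 0 \<le> Re z \<and> Re z \<le> 1}"
  by (auto simp: closed_segment_def complex_eq_iff)

lemma windmill_arc_spoke: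
  assumes "0 < i"
  shows "arc (windmill_arc {0, i})" "pathstart (windmill_arc {0, i}) = 0"
    "pathfinish (windmill_arc {0, i}) = Complex 1 i"
    "path_image (windmill_arc {0, i}) = {z. Im z = Re z * i \<and> 0 \<le> Re z \<and> Re z \<le> 1}"
  using assms closed_segment_0_Complex[of "real i"]
  by (auto simp: windmill_arc_def windmill_pos_def complex_eq_iff)

lemma windmill_arc_rim:
  fixes j :: nat
  defines "e \<equiv> {2 * j + 1, 2 * j + 2}"
  shows "arc (windmill_arc e)" "pathstart (windmill_arc e) = Complex 1 (2 * real j + 1)"
    "pathfinish (windmill_arc e) = Complex 1 (2 * real j + 2)"
    "path_image (windmill_arc e) = {z. Re z = 1 \<and> 2 * real j + 1 \<le> Im z \<and> Im z \<le> 2 * real j + 2}"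
  by (auto simp: e_def windmill_arc_def windmill_pos_def complex_eq_iff closed_segment_same_Re
      closed_segment_eq_real_ivl)

lemma inj_windmill_pos: "inj_on windmill_pos A"
  by (auto simp: inj_on_def windmill_pos_def complex_eq_iff split: if_splits)

text \<open>Spokes have different slopes and meet only at the hub, rim edges occupy disjoint
  intervals of the line Re z = 1, and a spoke reaches that line only at its end.\<close>

lemma planar_embedding_windmill: "planar_embedding ({..<n}, windmill_edges n) windmill_pos windmill_arc"
proof -
  have ends: "arc (windmill_arc e) \<and> {pathstart (windmill_arc e), pathfinish (windmill_arc e)} = windmill_pos ` e \<and>
      path_image (windmill_arc e) \<inter> windmill_pos ` {..<n} = windmill_pos ` e" if "e \<in> windmill_edges n" for e
    using that
  proof (cases rule: windmill_edges_cases)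
    case (1 i)
    have "k \<in> e" if "windmill_pos k \<in> path_image (windmill_arc e)" for k
      using that windmill_arc_spoke[OF 1(2)] 1 by (auto simp: windmill_pos_def split: if_splits)
    moreover have "windmill_pos ` e \<subseteq> path_image (windmill_arc e) \<inter> windmill_pos ` {..<n}"
      using windmill_arc_spoke[OF 1(2)] 1 by (auto simp: windmill_pos_def)
    ultimately show ?thesis using windmill_arc_spoke[OF 1(2)] 1 by (auto simp: windmill_pos_def)
  next
    case (2 j)
    have on_e: "k \<in> e" if "windmill_pos k \<in> path_image (windmill_arc e)" for k
    proof -
      have "k \<noteq> 0 \<and> 2 * real j + 1 \<le> real k \<and> real k \<le> 2 * real j + 2"
        using that windmill_arc_rim[of j] 2 by (auto simp: windmill_pos_def split: if_splits)
      then have "2 * j + 1 \<le> k \<and> k \<le> 2 * j + 2" by linarith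
      then show ?thesis using 2 by auto
    qed
    have pos_e: "windmill_pos ` e = {Complex 1 (2 * real j + 1), Complex 1 (2 * real j + 2)}"
      using 2 by (simp add: windmill_pos_def add.commute)
    have "windmill_pos ` e \<subseteq> path_image (windmill_arc e)"
      using windmill_arc_rim(4)[of j] 2 unfolding pos_e by simp
    moreover have "e \<subseteq> {..<n}" using 2 by auto
    ultimately have "path_image (windmill_arc e) \<inter> windmill_pos ` {..<n} = windmill_pos ` e"
      using on_e by blast
    moreover have "arc (windmill_arc e)"
      "{pathstart (windmill_arc e), pathfinish (windmill_arc e)} = windmill_pos ` e"
      unfolding pos_e using windmill_arc_rim(1-3)[of j] 2(1) by simp_all
    ultimately show ?thesis by simp
  qed
  have spokes: "path_image (windmill_arc {0, i}) \<inter> path_image (windmill_arc {0, k}) \<subseteq> {windmill_pos 0}"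
    if "0 < i" "0 < k" "i \<noteq> k" for i k
    using that windmill_arc_spoke(4)[of i] windmill_arc_spoke(4)[of k] by (auto simp: windmill_pos_def complex_eq_iff)
  have mixed: "path_image (windmill_arc {0, i}) \<inter> path_image (windmill_arc {2 * j + 1, 2 * j + 2}) \<subseteq>
      windmill_pos ` ({0, i} \<inter> {2 * j + 1, 2 * j + 2})" if "0 < i" for i j
  proof
    fix z assume "z \<in> path_image (windmill_arc {0, i}) \<inter> path_image (windmill_arc {2 * j + 1, 2 * j + 2})"
    then have z: "Re z = 1" "Im z = real i" "2 * real j + 1 \<le> real i" "real i \<le> 2 * real j + 2"
      using windmill_arc_spoke(4)[OF that] windmill_arc_rim(4)[of j] by auto
    then have "2 * j + 1 \<le> i \<and> i \<le> 2 * j + 2" by linarith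
    then have "i \<in> {2 * j + 1, 2 * j + 2}" by auto
    moreover have "z = windmill_pos i" using z that by (auto simp: windmill_pos_def complex_eq_iff)
    ultimately show "z \<in> windmill_pos ` ({0, i} \<inter> {2 * j + 1, 2 * j + 2})" by blast
  qed
  have rims: "path_image (windmill_arc {2 * i + 1, 2 * i + 2}) \<inter> path_image (windmill_arc {2 * j + 1, 2 * j + 2}) = {}"
    if "i \<noteq> j" for i j
  proof -
    have "i + 1 \<le> j \<or> j + 1 \<le> i" using that by linarith
    then have "real i + 1 \<le> real j \<or> real j + 1 \<le> real i"
      by (metis of_nat_1 of_nat_add of_nat_le_iff)
    then show ?thesis using windmill_arc_rim(4)[of i] windmill_arc_rim(4)[of j] by auto
  qed
  \<comment> \<open>The converse inclusion holds because every arc passes through the positions of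
    its endpoints.\<close>
  have int: "path_image (windmill_arc e) \<inter> path_image (windmill_arc e') \<subseteq> windmill_pos ` (e \<inter> e')"
    if e: "e \<in> windmill_edges n" and e': "e' \<in> windmill_edges n" and "e \<noteq> e'" for e e'
    using e
  proof (cases rule: windmill_edges_cases)
    case i: (1 i)
    from e' show ?thesis
    proof (cases rule: windmill_edges_cases)
      case (1 k)
      then show ?thesis using spokes[of i k] i \<open>e \<noteq> e'\<close> by auto
    next
      case (2 j)
      then show ?thesis using mixed[of i j] i by simp
    qed
  next
    case i: (2 i)
    from e' show ?thesis
    proof (cases rule: windmill_edges_cases)
      case (1 k)
      then show ?thesis using mixed[of k i] i by (simp add: Int_commute)
    next
      case (2 j)
      then show ?thesis using rims[of i j] i \<open>e \<noteq> e'\<close> by auto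
    qed
  qed
  have "path_image (windmill_arc e) \<inter> path_image (windmill_arc e') = windmill_pos ` (e \<inter> e')"
    if "e \<in> windmill_edges n" "e' \<in> windmill_edges n" "e \<noteq> e'" for e e'
    using int[OF that] ends[OF that(1)] ends[OF that(2)] by blast
  then show ?thesis
    using ends inj_windmill_pos unfolding planar_embedding_def by simp
qed

text \<open>The complement of a convex set containing \<open>S\<close> belongs to
  \<open>outside S\<close>, so \<open>z\<close> is a limit of outside points without being
  one.\<close>

lemma closure_complement_in_frontier_outside:
  fixes S T :: "'a::{real_normed_vector,perfect_space} set"
  assumes "convex T" "S \<subseteq> T" "z \<in> S" "z \<in> closure (- T)"
  shows "z \<in> frontier (outside S)"
proof -
  have "z \<in> closure (outside S)"
    using assms(4) closure_mono[OF outside_subset_convex[OF assms(1,2)]] by blast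
  moreover have "z \<notin> interior (outside S)"
    using assms(3) interior_subset[of "outside S"] outside_no_overlap[of S] by blast
  ultimately show ?thesis by (simp add: frontier_def)
qed

text \<open>The drawing lies between the lines Re z = 0 and Re z = 1. The convex set containing it
  is the half-plane \<open>0 \<le> Re w\<close> for the hub and \<open>Re w \<le> 1\<close> for the
  other vertices.\<close>

lemma outerplanar_windmill: "outerplanar ({..<n}, windmill_edges n)"
  unfolding outerplanar_def
proof (intro exI conjI)
  show "planar_embedding ({..<n}, windmill_edges n) windmill_pos windmill_arc"
    by (rule planar_embedding_windmill)
  let ?D = "drawing ({..<n}, windmill_edges n) windmill_pos windmill_arc"
  have edge: "0 \<le> Re z \<and> Re z \<le> 1" if "z \<in> path_image (windmill_arc e)" "e \<in> windmill_edges n" for z e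
    using that(2)
  proof (cases rule: windmill_edges_cases)
    case (1 i)
    then show ?thesis using that(1) windmill_arc_spoke(4)[OF 1(2)] by auto
  next
    case (2 j)
    then show ?thesis using that(1) windmill_arc_rim(4)[of j] by auto
  qed
  have strip: "0 \<le> Re z \<and> Re z \<le> 1" if "z \<in> ?D" for z
    using that edge by (auto simp: drawing_def windmill_pos_def)
  have right: "z \<in> closure (- {w. Re w \<le> 1})" if "Re z = 1" for z
  proof -
    have "- {w. Re w \<le> 1} = {w. 1 < Re w}" by auto
    moreover have "(\<lambda>k. z + of_real (inverse (real (Suc k)))) \<longlonglongrightarrow> z + of_real 0"
      by (intro tendsto_intros LIMSEQ_inverse_real_of_nat)
    ultimately show ?thesis
      using that unfolding closure_sequential
      by (intro exI[of _ "\<lambda>k. z + of_real (inverse (real (Suc k)))"]) auto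
  qed
  have left: "0 \<in> closure (- {w. 0 \<le> Re w})"
  proof -
    have "- {w. 0 \<le> Re w} = {w. Re w < 0}" by auto
    moreover have "(\<lambda>k. - complex_of_real (inverse (real (Suc k)))) \<longlonglongrightarrow> - of_real 0"
      by (intro tendsto_intros LIMSEQ_inverse_real_of_nat)
    ultimately show ?thesis
      unfolding closure_sequential
      by (intro exI[of _ "\<lambda>k. - complex_of_real (inverse (real (Suc k)))"]) auto
  qed
  show "windmill_pos ` verts ({..<n}, windmill_edges n) \<subseteq> frontier (outside ?D)"
  proof
    fix z assume "z \<in> windmill_pos ` verts ({..<n}, windmill_edges n)"
    then obtain i where i: "i < n" "z = windmill_pos i" by auto
    then have zD: "z \<in> ?D" by (auto simp: drawing_def)
    show "z \<in> frontier (outside ?D)"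
    proof (cases "i = 0")
      case True
      then show ?thesis
        using left zD strip i
        by (intro closure_complement_in_frontier_outside[of "{w. 0 \<le> Re w}"])
          (auto simp: windmill_pos_def convex_halfspace_Re_ge)
    next
      case False
      then show ?thesis
        using right zD strip i
        by (intro closure_complement_in_frontier_outside[of "{w. Re w \<le> 1}"])
          (auto simp: windmill_pos_def convex_halfspace_Re_le)
    qed
  qed
qed

section \<open>The extremal number\<close>

lemma windmill_admissible:
  assumes "0 < n"
  shows "({..<n}, windmill_edges n) \<in> admissible_graphs n (double_star 2 2)"
  using assms simple_graph_windmill connected_graph_windmill outerplanar_windmill H_free_of_S22_free[OF S22_free_windmill]
  by (simp add: admissible_graphs_def)

theorem theorem2:
  fixes n :: nat
  assumes "n \<ge> 6"
  shows "int (ex_c_OP n (double_star 2 2)) = \<lfloor>3 * (real n - 1) / 2\<rfloor>"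
proof -
  have "ex_c_OP n (double_star 2 2) = 3 * (n - 1) div 2"
    unfolding ex_c_OP_def
  proof (rule Max_eqI)
    show "finite ((\<lambda>G. card (edges G)) ` admissible_graphs n (double_star 2 2))"
      by (rule finite_admissible_edge_counts)
    show "3 * (n - 1) div 2 \<in> (\<lambda>G. card (edges G)) ` admissible_graphs n (double_star 2 2)"
      using windmill_admissible[of n] card_windmill_edges[of n] assms by (intro image_eqI) auto
    show "k \<le> 3 * (n - 1) div 2"
      if "k \<in> (\<lambda>G. card (edges G)) ` admissible_graphs n (double_star 2 2)" for k
      using that admissible_edge_bound[OF _ assms] by fastforce
  qed
  \<comment> \<open>Division on natural numbers rounds down like the floor, and
    \<open>n \<ge> 6\<close> makes the truncated \<open>n - 1\<close> exact.\<close>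
  moreover have "\<lfloor>3 * (real n - 1) / 2\<rfloor> = int (3 * (n - 1) div 2)"
  proof -
    have "3 * (real n - 1) / 2 = real_of_int (int (3 * (n - 1))) / real_of_int 2"
      using assms by (simp add: of_nat_diff)
    also have "\<lfloor>\<dots>\<rfloor> = int (3 * (n - 1)) div 2"
      by (rule floor_divide_of_int_eq)
    finally show ?thesis by (simp add: zdiv_int)
  qed
  ultimately show ?thesis by simp
qed

end
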